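(* Let $\boldsymbol X,\boldsymbol X_i$, $i\ge 1$, be iid random vectors whose common distribution has standard case hidden domain of attraction, with $\tilde\nu^0$, $S^0$, $\nu_1$, $\delta\aleph^{(2)}$ and the modified anti-ranks $R^{1,(2)}_i,R^{2,(2)}_i$ as in the context. The convergence $$\frac1k\sum_{i=1}^n\epsilon_{\left(k/R^{1,(2)}_i,\ k/R^{2,(2)}_i\right)}(\cdot)\Rightarrow\tilde\nu^0(\cdot)\quad\text{in }M_+((0,\infty]^2)\qquad(k\to\infty,\ n/k\to\infty)$$ is equivalent to $$\widehat{\nu_1\times S^0}_n(\cdot):=\frac1k\sum_{i=1}^n\epsilon_{\left(\frac{k}{R^{1,(2)}_i\vee R^{2,(2)}_i},\left(\frac{R^{1,(2)}_i\vee R^{2,(2)}_i}{R^{1,(2)}_i},\frac{R^{1,(2)}_i\vee R^{2,(2)}_i}{R^{2,(2)}_i}\right)\right)}(\cdot)\Rightarrow\nu_1\times S^0(\cdot)$$ in $M_+((0,\infty]\times\delta\aleph^{(2)})$ $(k\to\infty,\ n/k\to\infty)$.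
   Context: Notation. Superscripts denote components: $\boldsymbol x=(x^1,x^2)$; $x^{(2)}=x^1\wedge x^2$; $\boldsymbol 1=(1,1)$. $M_+(F)$ is the set of nonnegative Radon measures on $F$ with the vague topology; $\stackrel{v}{\rightarrow}$ is vague convergence; $\Rightarrow$ is weak convergence (here of random elements of $M_+$). $\epsilon_x$ is the unit point mass at $x$. $k=k(n)$ is a sequence with $k\to\infty$, $n/k\to\infty$ as $n\to\infty$. $\nu_1$ is the Pareto measure on $(0,\infty]$ with $\nu_1((y,\infty])=y^{-1}$, $y>0$. $\delta\aleph^{(2)}=\{\boldsymbol x\in(0,\infty]^2:x^{(2)}=1\}$. Standard case hidden domain of attraction. The distribution of $\boldsymbol X=(X^1,X^2)$ has standard case hidden domain of attraction on the cone $E^0$ (either $(-\infty,\infty]^2$ or $(0,\infty]^2$) if: (i) $X^1\stackrel{d}{=}X^2$; (ii) with $E=[-\infty,\infty]^2\setminus\{(-\infty,-\infty)\}$ or $E=[0,\infty]^2\setminus\{(0,0)\}$, there are $a_n>0$, $b_n\in\mathbb R$ such that $nP[(\boldsymbol X-b_n\boldsymbol 1)/a_n\in\cdot]\stackrel{v}{\rightarrow}\nu(\cdot)$ in $M_+(E)$, where $\nu(\{\boldsymbol z\in E:z^1\le x^1,z^2\le x^2\}^c)=-\log G^1(x^1)-\log G^2(x^2)$ for nondegenerate extreme value distributions $G^1,G^2$ (asymptotic independence); (iii) there are $c_n>0$, $d_n\in\mathbb R$ and a nonzero $\nu^0\in M_+(E^0)$ with $nP[(\boldsymbol X-d_n\boldsymbol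 1)/c_n\in\cdot]\stackrel{v}{\rightarrow}\nu^0(\cdot)$ in $M_+(E^0)$. The distribution of $X^{(2)}=X^1\wedge X^2$ is then in a maximal domain of attraction with constants $c_n,d_n$; the cone is $E^0=(0,\infty]^2$ if its extreme value index is positive and $(-\infty,\infty]^2$ otherwise. The measures $\tilde\nu^0$ and $S^0$. Let $H^{(2)}$ be the distribution function of $X^{(2)}$ and $U^{(2)}(x)=1/(1-H^{(2)}(x))$ (extended valued). Under hidden domain of attraction, $nP[n^{-1}(U^{(2)}(X^1),U^{(2)}(X^2))\in\cdot]\stackrel{v}{\rightarrow}\tilde\nu^0(\cdot)$ in $M_+((0,\infty]^2)$, which defines the Radon measure $\tilde\nu^0$; and $S^0$ (the standardized hidden spectral measure) is the probability measure on $\delta\aleph^{(2)}$ given by $\tilde\nu^0(\{\boldsymbol x\in(0,\infty]^2:x^{(2)}\ge r,\ \boldsymbol x/x^{(2)}\in\Lambda\})=r^{-1}S^0(\Lambda)$ for $r>0$ and Borel $\Lambda\subset\delta\aleph^{(2)}$. Modified anti-ranks. With $X^{(2)}_j=X^1_j\wedge X^2_j$, for $i=1,\dots,n$, $R^{1,(2)}_i=|\{j\le n:X^{(2)}_j\ge X^1_i\}|$ and $R^{2,(2)}_i=|\{j\le n:X^{(2)}_j\ge X^2_i\}|$, where $|\cdot|$ is cardinality. One of these may equal $0$ (their maximum is at least $1$); division of a positive number by $0$ gives $\infty$. *)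

theory Defs
  imports "HOL-Probability.Probability"
begin

section \<open>Radon measures, the vague topology, weak convergence\<close>

text \<open>All state spaces \<open>F\<close> below are locally compact with a countable base, so Radon measures are
  the Borel measures on \<open>F\<close> that are finite on compact sets.\<close>

definition radon_measures :: "'b::topological_space set \<Rightarrow> 'b measure set" where
  "radon_measures F = {\<mu>. sets \<mu> = sets (restrict_space borel F) \<and>
     (\<forall>K. compact K \<and> K \<subseteq> F \<longrightarrow> emeasure \<mu> K < \<infinity>)}"

definition ck_plus :: "'b::topological_space set \<Rightarrow> ('b \<Rightarrow> real) set" where
  "ck_plus F = {f. continuous_on F f \<and> (\<forall>x\<in>F. 0 \<le> f x) \<and>
     (\<exists>K. compact K \<and> K \<subseteq> F \<and> (\<forall>x\<in>F - K. f x = 0))}"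

definition vague_topology :: "'b::topological_space set \<Rightarrow> 'b measure topology" where
  "vague_topology F = topology_generated_by
     {{\<mu> \<in> radon_measures F. (\<integral>x. f x \<partial>\<mu>) \<in> U} | f U. f \<in> ck_plus F \<and> open U}"

lemma topspace_vague_topology: "topspace (vague_topology F) = radon_measures F"
proof -
  have "(\<lambda>_. 0) \<in> ck_plus F" for F :: "'b::topological_space set"
    by (auto simp: ck_plus_def intro!: exI[of _ "{}"])
  then show ?thesis
    unfolding vague_topology_def topology_generated_by_topspace
    by (auto intro!: exI[of _ "radon_measures F"] exI[of _ "\<lambda>_. 0"] exI[of _ UNIV])
qed

definition vaguely_converges ::
  "'b::topological_space set \<Rightarrow> (nat \<Rightarrow> 'b measure) \<Rightarrow> 'b measure \<Rightarrow> bool" where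
  "vaguely_converges F \<mu> \<nu> \<longleftrightarrow> limitin (vague_topology F) \<mu> \<nu> sequentially"

definition borel_of :: "'b topology \<Rightarrow> 'b measure" where
  "borel_of T = sigma (topspace T) {U. openin T U}"

text \<open>Weak convergence of the random elements \<open>Y n\<close> of \<open>T\<close> to the random element \<open>Z\<close>. As only the
  laws matter, \<open>Z\<close> is taken on the same probability space; a nonrandom limit is a constant \<open>Z\<close>.\<close>

definition weakly_converges ::
  "'b topology \<Rightarrow> 'a measure \<Rightarrow> (nat \<Rightarrow> 'a \<Rightarrow> 'b) \<Rightarrow> ('a \<Rightarrow> 'b) \<Rightarrow> bool" where
  "weakly_converges T M Y Z \<longleftrightarrow>
     (\<forall>n. Y n \<in> measurable M (borel_of T)) \<and> Z \<in> measurable M (borel_of T) \<and>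
     (\<forall>g. continuous_map T euclideanreal g \<and> bounded (g ` topspace T) \<longrightarrow>
       (\<lambda>n. \<integral>\<omega>. g (Y n \<omega>) \<partial>M) \<longlonglongrightarrow> (\<integral>\<omega>. g (Z \<omega>) \<partial>M))"

text \<open>The measure \<open>A \<mapsto> r * D (T -` A)\<close> on the Borel subsets \<open>A\<close> of \<open>F\<close>; mass that \<open>T\<close> sends
  outside \<open>F\<close> is discarded.\<close>

definition scaled_image ::
  "'b::topological_space set \<Rightarrow> real \<Rightarrow> 'a measure \<Rightarrow> ('a \<Rightarrow> 'b) \<Rightarrow> 'b measure" where
  "scaled_image F r D T = scale_measure (ennreal r) (restrict_space (distr D borel T) F)"

text \<open>\<open>(1/k) * (\<Sum>i=1..n. \<epsilon>\<^bsub>x i\<^esub>)\<close>, as a scaled image of counting measure.\<close>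

definition empirical_measure ::
  "'b::topological_space set \<Rightarrow> real \<Rightarrow> nat \<Rightarrow> (nat \<Rightarrow> 'b) \<Rightarrow> 'b measure" where
  "empirical_measure F k n x = scaled_image F (1 / k) (count_space {1..n}) x"

lemma emeasure_empirical_measure:
  assumes "F \<in> sets borel" "A \<in> sets (restrict_space borel F)"
  shows "emeasure (empirical_measure F k n x) A
    = ennreal (1 / k) * (\<Sum>i=1..n. indicator A (x i))"
proof -
  have A: "A \<in> sets borel" "A \<subseteq> F"
    using assms by (auto simp: sets_restrict_space_iff)
  have "emeasure (restrict_space (distr (count_space {1..n}) borel x) F) A
      = emeasure (distr (count_space {1..n}) borel x) A"
    using assms A by (subst emeasure_restrict_space) auto
  also have "\<dots> = emeasure (count_space {1..n}) {i\<in>{1..n}. x i \<in> A}"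
    using A by (subst emeasure_distr) (auto simp: vimage_def Int_def conj_commute)
  also have "\<dots> = of_nat (card {i\<in>{1..n}. x i \<in> A})"
    by (subst emeasure_count_space_finite) auto
  also have "\<dots> = (\<Sum>i=1..n. indicator A (x i))"
    by (simp add: indicator_def sum.If_cases Int_def)
  finally show ?thesis
    by (simp add: empirical_measure_def scaled_image_def)
qed

section \<open>Extreme value distributions\<close>

definition gev :: "real \<Rightarrow> real \<Rightarrow> real" where
  "gev \<gamma> x = (if \<gamma> = 0 then exp (- exp (- x))
     else if 1 + \<gamma> * x > 0 then exp (- ((1 + \<gamma> * x) powr (- 1 / \<gamma>)))
     else if \<gamma> > 0 then 0 else 1)"

text \<open>The nondegenerate extreme value distribution functions with extreme value index \<open>\<gamma>\<close>, in
  arbitrary location and scale.\<close>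

definition extreme_value_df :: "real \<Rightarrow> (real \<Rightarrow> real) \<Rightarrow> bool" where
  "extreme_value_df \<gamma> G \<longleftrightarrow> (\<exists>a b. a > 0 \<and> G = (\<lambda>x. gev \<gamma> (a * x + b)))"

text \<open>\<open>H\<close> is in the maximal domain of attraction of an extreme value distribution with index
  \<open>\<gamma>\<close>, with norming constants \<open>c n > 0\<close> and \<open>d n\<close>.\<close>

definition max_domain_of_attraction ::
  "real \<Rightarrow> (nat \<Rightarrow> real) \<Rightarrow> (nat \<Rightarrow> real) \<Rightarrow> (real \<Rightarrow> real) \<Rightarrow> bool" where
  "max_domain_of_attraction \<gamma> c d H \<longleftrightarrow> (\<forall>n. c n > 0) \<and>
     (\<exists>G. extreme_value_df \<gamma> G \<and> weak_conv (\<lambda>n x. H (c n * x + d n) ^ n) G)"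

definition neg_log :: "real \<Rightarrow> ennreal" where
  "neg_log u = (if u = 0 then \<infinity> else ennreal (- ln u))"

section \<open>Hidden domain of attraction\<close>

text \<open>Throughout, \<open>D\<close> is the distribution of \<open>(X\<^sup>1, X\<^sup>2)\<close> on the plane.\<close>

definition pos_quadrant :: "(ereal \<times> ereal) set" where
  "pos_quadrant = {0<..} \<times> {0<..}"

definition E_full :: "(ereal \<times> ereal) set" where
  "E_full = UNIV - {(-\<infinity>, -\<infinity>)}"

definition E_nonneg :: "(ereal \<times> ereal) set" where
  "E_nonneg = {0..} \<times> {0..} - {(0, 0)}"

definition hidden_cone :: "real \<Rightarrow> (ereal \<times> ereal) set" where
  "hidden_cone \<gamma> = (if \<gamma> > 0 then pos_quadrant else {-\<infinity><..} \<times> {-\<infinity><..})"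

text \<open>The measure \<open>n P[(X - b(1,1))/a \<in> \<cdot>]\<close> on \<open>F\<close>.\<close>

definition normed_law ::
  "(ereal \<times> ereal) set \<Rightarrow> (real \<times> real) measure \<Rightarrow> nat \<Rightarrow> real \<Rightarrow> real \<Rightarrow> (ereal \<times> ereal) measure" where
  "normed_law F D n a b =
     scaled_image F (real n) D (\<lambda>(x1, x2). (ereal ((x1 - b) / a), ereal ((x2 - b) / a)))"

definition min_df :: "(real \<times> real) measure \<Rightarrow> real \<Rightarrow> real" where
  "min_df D = cdf (distr D borel (\<lambda>(x1, x2). min x1 x2))"

definition asymptotically_independent_doa :: "(real \<times> real) measure \<Rightarrow> bool" where
  "asymptotically_independent_doa D \<longleftrightarrow>
     (\<exists>E \<in> {E_full, E_nonneg}. \<exists>a b \<nu> \<gamma>1 \<gamma>2 G1 G2.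
        (\<forall>n. a n > 0) \<and> vaguely_converges E (\<lambda>n. normed_law E D n (a n) (b n)) \<nu> \<and>
        extreme_value_df \<gamma>1 G1 \<and> extreme_value_df \<gamma>2 G2 \<and>
        (\<forall>x1 x2 :: real. (ereal x1, ereal x2) \<in> E \<longrightarrow>
           emeasure \<nu> (E - {(z1, z2). z1 \<le> ereal x1 \<and> z2 \<le> ereal x2})
             = neg_log (G1 x1) + neg_log (G2 x2)))"

text \<open>The cone is selected by the extreme value index of the minimum, whose membership in a maximal
  domain of attraction with the constants \<open>c n\<close>, \<open>d n\<close> is therefore part of the definition. It also
  rules out degenerate limits such as a point mass at \<open>(\<infinity>, \<infinity>)\<close>, which arise from any continuous
  distribution of the minimum when \<open>c n\<close> decreases too fast.\<close>

definition standard_case_hidden_doa :: "(real \<times> real) measure \<Rightarrow> bool" where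
  "standard_case_hidden_doa D \<longleftrightarrow>
     distr D borel fst = distr D borel snd \<and>
     asymptotically_independent_doa D \<and>
     (\<exists>\<gamma> c d \<nu>0. max_domain_of_attraction \<gamma> c d (min_df D) \<and>
        vaguely_converges (hidden_cone \<gamma>) (\<lambda>n. normed_law (hidden_cone \<gamma>) D n (c n) (d n)) \<nu>0 \<and>
        emeasure \<nu>0 (hidden_cone \<gamma>) \<noteq> 0)"

definition U2 :: "(real \<times> real) measure \<Rightarrow> real \<Rightarrow> ereal" where
  "U2 D x = 1 / ereal (1 - min_df D x)"

definition standardized_hidden_measure ::
  "(real \<times> real) measure \<Rightarrow> (ereal \<times> ereal) measure \<Rightarrow> bool" where
  "standardized_hidden_measure D \<nu>t \<longleftrightarrow> vaguely_converges pos_quadrant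
     (\<lambda>n. scaled_image pos_quadrant (real n) D
       (\<lambda>(x1, x2). (U2 D x1 / ereal (real n), U2 D x2 / ereal (real n)))) \<nu>t"

definition delta_aleph :: "(ereal \<times> ereal) set" where
  "delta_aleph = {(x1, x2). (x1, x2) \<in> pos_quadrant \<and> min x1 x2 = 1}"

text \<open>At \<open>(\<infinity>, \<infinity>)\<close>, where \<open>x / x\<^sup>(\<^sup>2\<^sup>)\<close> is undefined, division in \<^typ>\<open>ereal\<close> gives \<open>(0, 0)\<close>, so
  that this point lies in none of the sets on the left.\<close>

definition hidden_spectral_measure ::
  "(ereal \<times> ereal) measure \<Rightarrow> (ereal \<times> ereal) measure \<Rightarrow> bool" where
  "hidden_spectral_measure \<nu>t S0 \<longleftrightarrow>
     prob_space S0 \<and> sets S0 = sets (restrict_space borel delta_aleph) \<and>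
     (\<forall>r > 0. \<forall>\<Lambda> \<in> sets (restrict_space borel delta_aleph).
        emeasure \<nu>t {(x1, x2). (x1, x2) \<in> pos_quadrant \<and> min x1 x2 \<ge> ereal r \<and>
                        (x1 / min x1 x2, x2 / min x1 x2) \<in> \<Lambda>}
          = ennreal (1 / r) * emeasure S0 \<Lambda>)"

text \<open>The Pareto measure on \<open>(0, \<infinity>]\<close>, realized as the image of Lebesgue measure under
  \<open>t \<mapsto> 1/t\<close>.\<close>

definition nu1 :: "ereal measure" where
  "nu1 = restrict_space (distr (restrict_space lborel {0<..}) borel (\<lambda>t. ereal (1 / t))) {0<..}"

lemma nu1_tail:
  assumes "y > 0"
  shows "emeasure nu1 {ereal y<..} = ennreal (1 / y)"
proof -
  have "emeasure nu1 {ereal y<..}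
      = emeasure (distr (restrict_space lborel {0<..}) borel (\<lambda>t. ereal (1 / t))) {ereal y<..}"
    using assms unfolding nu1_def by (subst emeasure_restrict_space) (auto simp: less_trans[of 0 "ereal y"])
  also have "\<dots> = emeasure (restrict_space lborel {0<..}) ((\<lambda>t. ereal (1 / t)) -` {ereal y<..} \<inter> {0<..})"
    by (subst emeasure_distr) (auto simp: space_restrict_space intro!: measurable_restrict_space1)
  also have "(\<lambda>t. ereal (1 / t)) -` {ereal y<..} \<inter> {0<..} = {0<..<1 / y}"
    using assms by (auto simp: field_simps)
  also have "emeasure (restrict_space lborel {0<..}) {0<..<1 / y} = ennreal (1 / y)"
    using assms by (subst emeasure_restrict_space) auto
  finally show ?thesis .
qed

section \<open>Modified anti-ranks\<close>

definition antirank1 :: "nat \<Rightarrow> (nat \<Rightarrow> real \<times> real) \<Rightarrow> nat \<Rightarrow> nat" where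
  "antirank1 n x i = card {j \<in> {1..n}. min (fst (x j)) (snd (x j)) \<ge> fst (x i)}"

definition antirank2 :: "nat \<Rightarrow> (nat \<Rightarrow> real \<times> real) \<Rightarrow> nat \<Rightarrow> nat" where
  "antirank2 n x i = card {j \<in> {1..n}. min (fst (x j)) (snd (x j)) \<ge> snd (x i)}"

text \<open>An anti-rank may be 0; in \<^typ>\<open>ereal\<close>, a positive number divided by 0 is \<open>\<infinity>\<close>.\<close>

definition rank_point :: "real \<Rightarrow> nat \<Rightarrow> (nat \<Rightarrow> real \<times> real) \<Rightarrow> nat \<Rightarrow> ereal \<times> ereal" where
  "rank_point k n x i =
     (ereal k / ereal (antirank1 n x i), ereal k / ereal (antirank2 n x i))"

definition polar_rank_point ::
  "real \<Rightarrow> nat \<Rightarrow> (nat \<Rightarrow> real \<times> real) \<Rightarrow> nat \<Rightarrow> ereal \<times> ereal \<times> ereal" where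
  "polar_rank_point k n x i =
     (let R1 = ereal (antirank1 n x i); R2 = ereal (antirank2 n x i); R = max R1 R2
      in (ereal k / R, (R / R1, R / R2)))"

definition rank_measure ::
  "real \<Rightarrow> nat \<Rightarrow> (nat \<Rightarrow> real \<times> real) \<Rightarrow> (ereal \<times> ereal) measure" where
  "rank_measure k n x = empirical_measure pos_quadrant k n (rank_point k n x)"

definition polar_rank_measure ::
  "real \<Rightarrow> nat \<Rightarrow> (nat \<Rightarrow> real \<times> real) \<Rightarrow> (ereal \<times> ereal \<times> ereal) measure" where
  "polar_rank_measure k n x =
     empirical_measure ({0<..} \<times> delta_aleph) k n (polar_rank_point k n x)"

end

theory Submission
  imports Defs
begin

text \<open>The polar map \<open>x \<mapsto> (x\<^sup>(\<^sup>2\<^sup>), x / x\<^sup>(\<^sup>2\<^sup>))\<close> carries the rank measure to the polar rank measure and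
  \<open>\<nu>t\<close> to \<open>nu1 \<Otimes>\<^sub>M S0\<close>; its left inverse \<open>(r, \<theta>) \<mapsto> r \<theta>\<close> is continuous and proper, so the
  convergence of the polar measures implies that of the rank measures. The polar map itself cannot be
  continuous at \<open>(\<infinity>, \<infinity>)\<close>. For the converse, a test function is therefore truncated to
  \<open>x\<^sup>(\<^sup>2\<^sup>) \<le> 2 t\<close>; the error is uniformly small because both the limit and the rank measures give
  mass at most \<open>1/t\<close> to \<open>{x\<^sup>(\<^sup>2\<^sup>) \<ge> t}\<close>, the latter since at most \<open>q\<close> of the indices have an anti-rank
  of the minimum of at most \<open>q\<close>. That \<open>\<nu>t\<close> has no atom at \<open>(\<infinity>, \<infinity>)\<close>, on which its spectral measure
  says nothing, follows from homogeneity.\<close>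

section \<open>Weak convergence to a nonrandom measure\<close>

text \<open>The obstacle is the corner (\<infinity>, \<infinity>). The points (s, s) and (s, 2 s)
  both tend to it as s grows, while their angles stay (1, 1) and (1, 2); conversely
  \<open>unpolar\<close> collapses all of {\<infinity>} \<times> \<open>delta_aleph\<close> to that
  single point. Since this set is a compact part of the polar space, a test function there may be
  nonconstant on it, and then its composition with \<open>polar\<close> is not a test function. Only
  one direction is therefore a plain change of variables.

  Both limits are nonrandom, so each weak convergence amounts to convergence in probability of the
  integral of every single test function, and the two sides can be compared one function at a time.
  The tail bound for the rank measures holds for every sample, so truncation changes these integrals
  by a deterministic amount that is uniform in n.

  An atom of \<nu>t at the corner would break the product formula, because \<open>nu1\<close> has no
  mass at \<infinity>.\<close>

lemma tendsto_zero_le: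
  fixes g h :: "nat \<Rightarrow> real"
  assumes "h \<longlonglongrightarrow> 0" "\<And>n. g n \<le> h n" "\<And>n. 0 \<le> g n"
  shows "g \<longlonglongrightarrow> 0"
  using tendsto_sandwich[OF _ _ tendsto_const assms(1), of g] assms(2,3) by auto

lemma openin_vague_subbasis:
  assumes "f \<in> ck_plus F" "open U"
  shows "openin (vague_topology F) {\<mu> \<in> radon_measures F. (\<integral>x. f x \<partial>\<mu>) \<in> U}"
  unfolding vague_topology_def by (rule topology_generated_by_Basis) (use assms in blast)

lemma continuous_map_vague_integral:
  assumes "f \<in> ck_plus F"
  shows "continuous_map (vague_topology F) euclideanreal (\<lambda>\<mu>. \<integral>x. f x \<partial>\<mu>)"
  using openin_vague_subbasis[OF assms]
  by (auto simp: continuous_map_def topspace_vague_topology)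

lemma vaguely_converges_integral:
  assumes "vaguely_converges F \<mu> \<nu>" "f \<in> ck_plus F"
  shows "(\<lambda>n. \<integral>x. f x \<partial>\<mu> n) \<longlonglongrightarrow> (\<integral>x. f x \<partial>\<nu>)"
  using continuous_map_limit[OF continuous_map_vague_integral[OF assms(2)]
      assms(1)[unfolded vaguely_converges_def]]
  by (simp add: o_def)

lemma space_borel_of: "space (borel_of T) = topspace T"
  unfolding borel_of_def by (rule space_measure_of) (auto dest: openin_subset)

lemma openin_in_sets_borel_of: "openin T U \<Longrightarrow> U \<in> sets (borel_of T)"
  unfolding borel_of_def by (subst sets_measure_of) (auto dest: openin_subset)

lemma continuous_map_measurable_borel_of:
  assumes "continuous_map T euclideanreal g"
  shows "g \<in> borel_measurable (borel_of T)"
proof (rule borel_measurableI)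
  fix S :: "real set" assume "open S"
  then have "openin T {x \<in> topspace T. g x \<in> S}"
    using assms by (auto simp: continuous_map_def)
  moreover have "g -` S \<inter> space (borel_of T) = {x \<in> topspace T. g x \<in> S}"
    by (auto simp: space_borel_of)
  ultimately show "g -` S \<inter> space (borel_of T) \<in> sets (borel_of T)"
    by (simp add: openin_in_sets_borel_of)
qed

text \<open>Weak convergence only tests bounded functions, so the deviation of the integral is
  capped at 1. The capped deviation is continuous and vanishes at \<nu>; its expectation tends to 0,
  and Markov's inequality at level \<open>min 1 \<epsilon>\<close> gives the probabilities.\<close>

lemma weakly_converges_constD:
  assumes M: "prob_space M" and w: "weakly_converges (vague_topology F) M Y (\<lambda>_. \<nu>)"
    and f: "f \<in> ck_plus F" and \<epsilon>: "\<epsilon> > 0"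
  shows "(\<lambda>n. measure M {\<omega> \<in> space M. \<bar>(\<integral>x. f x \<partial>Y n \<omega>) - (\<integral>x. f x \<partial>\<nu>)\<bar> \<ge> \<epsilon>}) \<longlonglongrightarrow> 0"
proof -
  interpret prob_space M by fact
  define a where "a = (\<integral>x. f x \<partial>\<nu>)"
  define g where "g \<mu> = min 1 \<bar>(\<integral>x. f x \<partial>\<mu>) - a\<bar>" for \<mu>
  have cont: "continuous_map (vague_topology F) euclideanreal g"
  proof -
    have "continuous_map (vague_topology F) euclideanreal ((\<lambda>t. min 1 \<bar>t - a\<bar>) \<circ> (\<lambda>\<mu>. \<integral>x. f x \<partial>\<mu>))"
      by (rule continuous_map_compose[OF continuous_map_vague_integral[OF f]])
         (auto intro!: continuous_intros)
    then show ?thesis by (simp add: g_def[abs_def] o_def)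
  qed
  have bd: "bounded (g ` topspace (vague_topology F))"
    unfolding bounded_iff by (rule exI[of _ 1]) (auto simp: g_def)
  have meas: "(\<lambda>\<omega>. g (Y n \<omega>)) \<in> borel_measurable M" for n
    using w continuous_map_measurable_borel_of[OF cont]
    by (auto simp: weakly_converges_def intro: measurable_compose)
  have "(\<lambda>n. \<integral>\<omega>. g (Y n \<omega>) \<partial>M) \<longlonglongrightarrow> (\<integral>\<omega>. g \<nu> \<partial>M)"
    using w cont bd by (auto simp: weakly_converges_def)
  moreover have "g \<nu> = 0" by (simp add: g_def a_def)
  ultimately have "(\<lambda>n. (\<integral>\<omega>. g (Y n \<omega>) \<partial>M) / min 1 \<epsilon>) \<longlonglongrightarrow> 0"
    by (auto intro: tendsto_divide_zero)
  moreover have "measure M {\<omega> \<in> space M. \<bar>(\<integral>x. f x \<partial>Y n \<omega>) - a\<bar> \<ge> \<epsilon>} \<le> (\<integral>\<omega>. g (Y n \<omega>) \<partial>M) / min 1 \<epsilon>" for n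
  proof -
    have "measure M {\<omega> \<in> space M. \<bar>(\<integral>x. f x \<partial>Y n \<omega>) - a\<bar> \<ge> \<epsilon>} \<le> measure M {\<omega> \<in> space M. min 1 \<epsilon> \<le> g (Y n \<omega>)}"
    proof (rule finite_measure_mono)
      show "{\<omega> \<in> space M. min 1 \<epsilon> \<le> g (Y n \<omega>)} \<in> sets M"
        using meas[of n] by measurable
    qed (auto simp: g_def)
    also have "\<dots> \<le> (\<integral>\<omega>. g (Y n \<omega>) \<partial>M) / min 1 \<epsilon>"
      by (rule integral_Markov_inequality_measure[where A="space M"])
         (use \<epsilon> meas in \<open>auto simp: g_def intro!: integrable_const_bound[where B=1]\<close>)
    finally show ?thesis .
  qed
  ultimately show ?thesis unfolding a_def[symmetric]
    by (rule tendsto_zero_le) auto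
qed

text \<open>The induction follows the generation of V from the subbasis: an intersection costs a
  union bound, for a union one member containing \<nu> is enough, and a subbasic set contains a ball
  of integral values around that of \<nu>, where the assumption applies.\<close>

lemma vague_nbhd_prob:
  assumes M: "prob_space M" and Y: "\<And>n. Y n \<in> measurable M (borel_of (vague_topology F))"
    and conv: "\<And>f \<epsilon>. f \<in> ck_plus F \<Longrightarrow> \<epsilon> > 0 \<Longrightarrow>
      (\<lambda>n. measure M {\<omega> \<in> space M. \<bar>(\<integral>x. f x \<partial>Y n \<omega>) - (\<integral>x. f x \<partial>\<nu>)\<bar> \<ge> \<epsilon>}) \<longlonglongrightarrow> 0"
    and V: "openin (vague_topology F) V" "\<nu> \<in> V"
  shows "(\<lambda>n. measure M {\<omega> \<in> space M. Y n \<omega> \<notin> V}) \<longlonglongrightarrow> 0"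
proof -
  interpret prob_space M by fact
  have sets: "{\<omega> \<in> space M. Y n \<omega> \<notin> V} \<in> sets M" if "openin (vague_topology F) V" for V n
  proof -
    have "space M - (Y n -` V \<inter> space M) \<in> sets M"
      by (intro sets.Diff sets.top measurable_sets[OF Y] openin_in_sets_borel_of that)
    also have "space M - (Y n -` V \<inter> space M) = {\<omega> \<in> space M. Y n \<omega> \<notin> V}" by auto
    finally show ?thesis .
  qed
  have sp: "Y n \<omega> \<in> radon_measures F" if "\<omega> \<in> space M" for n \<omega>
    using measurable_space[OF Y that] by (simp add: space_borel_of topspace_vague_topology)
  have "generate_topology_on {{\<mu> \<in> radon_measures F. (\<integral>x. f x \<partial>\<mu>) \<in> U} | f U. f \<in> ck_plus F \<and> open U} V"
    using V(1) by (simp add: vague_topology_def openin_topology_generated_by_iff)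
  then show ?thesis using V(2)
  proof (induction rule: generate_topology_on.induct)
    case Empty then show ?case by simp
  next
    case (Int a b)
    have ab: "openin (vague_topology F) a" "openin (vague_topology F) b"
      using Int.hyps by (simp_all add: vague_topology_def openin_topology_generated_by_iff)
    have "(\<lambda>n. measure M {\<omega> \<in> space M. Y n \<omega> \<notin> a} + measure M {\<omega> \<in> space M. Y n \<omega> \<notin> b}) \<longlonglongrightarrow> 0"
      using tendsto_add[OF Int.IH] Int.prems by auto
    moreover have "measure M {\<omega> \<in> space M. Y n \<omega> \<notin> a \<inter> b} \<le>
       measure M {\<omega> \<in> space M. Y n \<omega> \<notin> a} + measure M {\<omega> \<in> space M. Y n \<omega> \<notin> b}" for n
    proof -
      have "{\<omega> \<in> space M. Y n \<omega> \<notin> a \<inter> b} = {\<omega> \<in> space M. Y n \<omega> \<notin> a} \<union> {\<omega> \<in> space M. Y n \<omega> \<notin> b}" by auto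
      then show ?thesis using measure_Un_le[OF sets[OF ab(1)] sets[OF ab(2)]] by simp
    qed
    ultimately show ?case
      by (rule tendsto_zero_le) auto
  next
    case (UN K)
    then obtain k where k: "k \<in> K" "\<nu> \<in> k" by auto
    have "(\<lambda>n. measure M {\<omega> \<in> space M. Y n \<omega> \<notin> k}) \<longlonglongrightarrow> 0" using UN k by auto
    moreover have "openin (vague_topology F) k"
      using UN.hyps k by (simp add: vague_topology_def openin_topology_generated_by_iff)
    then have "measure M {\<omega> \<in> space M. Y n \<omega> \<notin> \<Union>K} \<le> measure M {\<omega> \<in> space M. Y n \<omega> \<notin> k}" for n
      using k by (intro finite_measure_mono sets) auto
    ultimately show ?case
      by (rule tendsto_zero_le) auto
  next
    case (Basis s)
    then obtain f U where s: "s = {\<mu> \<in> radon_measures F. (\<integral>x. f x \<partial>\<mu>) \<in> U}" and f: "f \<in> ck_plus F" and U: "open U"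
      by auto
    have "(\<integral>x. f x \<partial>\<nu>) \<in> U" using Basis s by auto
    with U obtain \<epsilon> where \<epsilon>: "\<epsilon> > 0" "\<And>t. dist t (\<integral>x. f x \<partial>\<nu>) < \<epsilon> \<Longrightarrow> t \<in> U"
      unfolding open_dist by metis
    have meas: "(\<lambda>\<omega>. \<integral>x. f x \<partial>Y n \<omega>) \<in> borel_measurable M" for n
      by (rule measurable_compose[OF Y continuous_map_measurable_borel_of[OF continuous_map_vague_integral[OF f]]])
    have "measure M {\<omega> \<in> space M. Y n \<omega> \<notin> s} \<le> measure M {\<omega> \<in> space M. \<bar>(\<integral>x. f x \<partial>Y n \<omega>) - (\<integral>x. f x \<partial>\<nu>)\<bar> \<ge> \<epsilon>}" for n
    proof (rule finite_measure_mono)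
      show "{\<omega> \<in> space M. Y n \<omega> \<notin> s} \<subseteq> {\<omega> \<in> space M. \<bar>(\<integral>x. f x \<partial>Y n \<omega>) - (\<integral>x. f x \<partial>\<nu>)\<bar> \<ge> \<epsilon>}"
        using \<epsilon>(2) sp by (fastforce simp: s dist_real_def not_less[symmetric])
    qed (use meas in simp)
    with conv[OF f \<epsilon>(1)] show ?case
      by (rule tendsto_zero_le) auto
  qed
qed

text \<open>Continuity of g at \<nu> gives a neighbourhood on which g differs from
  \<open>g \<nu>\<close> by less than \<epsilon> / 2. Off it the difference is at most 2 B, on an
  event whose probability tends to 0.\<close>

lemma weakly_converges_constI:
  assumes M: "prob_space M" and Y: "\<And>n. Y n \<in> measurable M (borel_of (vague_topology F))"
    and \<nu>: "\<nu> \<in> radon_measures F"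
    and conv: "\<And>f \<epsilon>. f \<in> ck_plus F \<Longrightarrow> \<epsilon> > 0 \<Longrightarrow>
      (\<lambda>n. measure M {\<omega> \<in> space M. \<bar>(\<integral>x. f x \<partial>Y n \<omega>) - (\<integral>x. f x \<partial>\<nu>)\<bar> \<ge> \<epsilon>}) \<longlonglongrightarrow> 0"
  shows "weakly_converges (vague_topology F) M Y (\<lambda>_. \<nu>)"
proof -
  interpret prob_space M by fact
  have sp: "Y n \<omega> \<in> radon_measures F" if "\<omega> \<in> space M" for n \<omega>
    using measurable_space[OF Y that] by (simp add: space_borel_of topspace_vague_topology)
  have "(\<lambda>n. \<integral>\<omega>. g (Y n \<omega>) \<partial>M) \<longlonglongrightarrow> g \<nu>"
    if g: "continuous_map (vague_topology F) euclideanreal g"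
      and bd: "bounded (g ` topspace (vague_topology F))" for g
  proof (rule tendstoI)
    fix \<epsilon> :: real assume \<epsilon>: "\<epsilon> > 0"
    obtain B where B: "\<And>\<mu>. \<mu> \<in> radon_measures F \<Longrightarrow> \<bar>g \<mu>\<bar> \<le> B" "B > 0"
      using bd by (auto simp: bounded_pos topspace_vague_topology)
    define V where "V = {\<mu> \<in> radon_measures F. g \<mu> \<in> ball (g \<nu>) (\<epsilon> / 2)}"
    have V: "openin (vague_topology F) V" "\<nu> \<in> V"
      using g \<epsilon> \<nu> open_ball[of "g \<nu>" "\<epsilon> / 2"]
      by (auto simp: V_def continuous_map_def topspace_vague_topology simp del: open_ball mem_ball)
    have meas[measurable]: "(\<lambda>\<omega>. g (Y n \<omega>)) \<in> borel_measurable M" for n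
      by (rule measurable_compose[OF Y continuous_map_measurable_borel_of[OF g]])
    have int: "integrable M (\<lambda>\<omega>. g (Y n \<omega>))" for n
      by (rule integrable_const_bound[where B=B]) (use B sp in auto)
    have NV: "{\<omega> \<in> space M. Y n \<omega> \<notin> V} \<in> sets M" for n
    proof -
      have "space M - (Y n -` V \<inter> space M) \<in> sets M"
        by (intro sets.Diff sets.top measurable_sets[OF Y] openin_in_sets_borel_of V)
      also have "space M - (Y n -` V \<inter> space M) = {\<omega> \<in> space M. Y n \<omega> \<notin> V}" by auto
      finally show ?thesis .
    qed
    have bound: "\<bar>(\<integral>\<omega>. g (Y n \<omega>) \<partial>M) - g \<nu>\<bar> \<le> \<epsilon> / 2 + 2 * B * measure M {\<omega> \<in> space M. Y n \<omega> \<notin> V}" for n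
    proof -
      have "\<bar>(\<integral>\<omega>. g (Y n \<omega>) \<partial>M) - g \<nu>\<bar> = \<bar>\<integral>\<omega>. g (Y n \<omega>) - g \<nu> \<partial>M\<bar>"
        using int by (simp add: prob_space)
      also have "\<dots> \<le> (\<integral>\<omega>. \<bar>g (Y n \<omega>) - g \<nu>\<bar> \<partial>M)"
        by (rule integral_abs_bound)
      also have "\<dots> \<le> (\<integral>\<omega>. \<epsilon> / 2 + 2 * B * indicator {\<omega> \<in> space M. Y n \<omega> \<notin> V} \<omega> \<partial>M)"
      proof (rule integral_mono)
        show "integrable M (\<lambda>\<omega>. \<epsilon> / 2 + 2 * B * indicator {\<omega> \<in> space M. Y n \<omega> \<notin> V} \<omega>)"
          using NV[of n] by (auto intro!: integrable_real_indicator simp: emeasure_eq_measure)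
        fix \<omega> assume \<omega>: "\<omega> \<in> space M"
        show "\<bar>g (Y n \<omega>) - g \<nu>\<bar> \<le> \<epsilon> / 2 + 2 * B * indicator {\<omega> \<in> space M. Y n \<omega> \<notin> V} \<omega>"
          using B(1)[OF sp[OF \<omega>, of n]] B(1)[OF \<nu>] \<omega> sp[OF \<omega>, of n] \<epsilon>
          by (auto simp: V_def indicator_def dist_real_def abs_minus_commute)
      qed (use int in auto)
      also have "\<dots> = \<epsilon> / 2 + 2 * B * measure M {\<omega> \<in> space M. Y n \<omega> \<notin> V}"
        using NV[of n] by (subst Bochner_Integration.integral_add)
          (auto intro!: integrable_real_indicator simp: emeasure_eq_measure prob_space)
      finally show ?thesis .
    qed
    have "(\<lambda>n. 2 * B * measure M {\<omega> \<in> space M. Y n \<omega> \<notin> V}) \<longlonglongrightarrow> 0"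
      using tendsto_mult[OF tendsto_const vague_nbhd_prob[OF M Y conv V], of "2 * B"] by simp
    then have "eventually (\<lambda>n. 2 * B * measure M {\<omega> \<in> space M. Y n \<omega> \<notin> V} < \<epsilon> / 2) sequentially"
      by (rule order_tendstoD(2)) (use \<epsilon> in simp)
    then show "eventually (\<lambda>n. dist (\<integral>\<omega>. g (Y n \<omega>) \<partial>M) (g \<nu>) < \<epsilon>) sequentially"
    proof eventually_elim
      case (elim n) then show ?case using bound[of n] by (simp add: dist_real_def)
    qed
  qed
  then show ?thesis
    using Y \<nu> by (auto simp: weakly_converges_def prob_space space_borel_of topspace_vague_topology)
qed

section \<open>Polar coordinates\<close>

lemma ck_plus_bounded:
  assumes "f \<in> ck_plus F"
  obtains B where "B > 0" "\<And>x. x \<in> F \<Longrightarrow> f x \<le> B"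
proof -
  obtain K where K: "compact K" "K \<subseteq> F" "\<And>x. x \<in> F - K \<Longrightarrow> f x = 0" and c: "continuous_on F f"
    using assms by (auto simp: ck_plus_def)
  have "bounded (f ` K)"
    by (intro compact_imp_bounded compact_continuous_image continuous_on_subset[OF c] K)
  then obtain B where B: "B > 0" "\<And>x. x \<in> K \<Longrightarrow> \<bar>f x\<bar> \<le> B"
    by (auto simp: bounded_pos)
  have "f x \<le> B" if "x \<in> F" for x
    using B K(3)[of x] that by (cases "x \<in> K") force+
  with B(1) show ?thesis by (rule that)
qed

lemma ck_plus_measurable:
  assumes "f \<in> ck_plus F" "sets \<mu> = sets (restrict_space borel F)"
  shows "f \<in> borel_measurable \<mu>"
  using borel_measurable_continuous_on_restrict[of F f] assms
  by (simp add: ck_plus_def measurable_cong_sets[OF assms(2) refl])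

lemma ck_plus_integrable:
  fixes f :: "'b::t2_space \<Rightarrow> real"
  assumes f: "f \<in> ck_plus F" and \<mu>: "\<mu> \<in> radon_measures F"
  shows "integrable \<mu> f"
proof -
  have s: "sets \<mu> = sets (restrict_space borel F)" using \<mu> by (simp add: radon_measures_def)
  have sp: "space \<mu> = F" using sets_eq_imp_space_eq[OF s] by (simp add: space_restrict_space)
  obtain K where K: "compact K" "K \<subseteq> F" "\<And>x. x \<in> F - K \<Longrightarrow> f x = 0"
    using f by (auto simp: ck_plus_def)
  obtain B where B: "B > 0" "\<And>x. x \<in> F \<Longrightarrow> f x \<le> B" using ck_plus_bounded[OF f] by blast
  have KM: "K \<in> sets \<mu>"
    using K(1,2) by (auto simp: s sets_restrict_space image_iff intro!: bexI[of _ K] borel_compact)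
  have "emeasure \<mu> K < \<infinity>" using \<mu> K by (auto simp: radon_measures_def)
  with KM have i: "integrable \<mu> (\<lambda>x. B * indicator K x)"
    by (auto intro!: integrable_real_indicator)
  show ?thesis
  proof (rule Bochner_Integration.integrable_bound[OF i ck_plus_measurable[OF f s]])
    show "AE x in \<mu>. norm (f x) \<le> norm (B * indicator K x)"
    proof (rule AE_I2)
      fix x assume x: "x \<in> space \<mu>"
      have "0 \<le> f x" using f x sp by (auto simp: ck_plus_def)
      then show "norm (f x) \<le> norm (B * indicator K x)"
        using B(2)[of x] B(1) K(3)[of x] x sp by (cases "x \<in> K") auto
    qed
  qed
qed

section \<open>The quadrant, the compact set of angles, and compactness near 0\<close>

lemma mem_pos_quadrant_iff: "x \<in> pos_quadrant \<longleftrightarrow> 0 < min (fst x) (snd x)"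
  by (cases x) (auto simp: pos_quadrant_def)

lemma open_pos_quadrant: "open pos_quadrant"
  unfolding pos_quadrant_def by (intro open_Times) auto

lemma delta_aleph_eq: "delta_aleph = {x. min (fst x) (snd x) = 1}"
  unfolding delta_aleph_def mem_pos_quadrant_iff by (auto simp del: min_less_iff_conj)

lemma closed_delta_aleph: "closed delta_aleph"
  unfolding delta_aleph_eq by (intro closed_Collect_eq continuous_intros)

lemma compact_atLeast_ereal: "compact {a::ereal..}"
  by (simp add: Extended_Real_Limits.compact_eq_closed)

lemma compact_delta_aleph: "compact delta_aleph"
proof -
  have "compact (UNIV \<times> UNIV :: (ereal \<times> ereal) set)"
    by (intro compact_Times Extended_Real_Limits.compact_UNIV)
  from closed_Int_compact[OF closed_delta_aleph this] show ?thesis by simp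
qed

text \<open>The only end that a compact subset of (0, \<infinity>] must avoid is 0, as \<infinity>
  belongs to the space. All supports below are controlled through such a lower bound on the minimum
  or the radius.\<close>

lemma compact_ereal_bounded_below:
  fixes S :: "ereal set"
  assumes "compact S" "S \<subseteq> {0<..}"
  obtains a where "0 < a" "S \<subseteq> {a..}"
proof (cases "S = {}")
  case True then show ?thesis using that[of 1] by auto
next
  case False
  then obtain a where "a \<in> S" "\<forall>s\<in>S. a \<le> s" using compact_attains_inf[OF assms(1)] by auto
  then show ?thesis using that[of a] assms(2) by auto
qed

text \<open>At \<open>(\<infinity>, \<infinity>)\<close> the angle is set to \<open>(1, 1)\<close>, so that \<^const>\<open>pos_quadrant\<close> is still mapped
  into \<open>{0<..} \<times> delta_aleph\<close> with left inverse \<open>unpolar\<close> below.\<close>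

definition polar :: "ereal \<times> ereal \<Rightarrow> ereal \<times> ereal \<times> ereal" where
  "polar x = (let m = min (fst x) (snd x)
     in (m, if m = \<infinity> then (1, 1) else (fst x / m, snd x / m)))"

definition unpolar :: "ereal \<times> ereal \<times> ereal \<Rightarrow> ereal \<times> ereal" where
  "unpolar y = (fst y * fst (snd y), fst y * snd (snd y))"

lemma fst_polar: "fst (polar x) = min (fst x) (snd x)"
  by (simp add: polar_def Let_def)

lemma polar_mem: "x \<in> pos_quadrant \<Longrightarrow> polar x \<in> {0<..} \<times> delta_aleph"
 apply (cases "fst x"; cases "snd x")
     apply (simp_all add: polar_def Let_def delta_aleph_eq mem_pos_quadrant_iff min_def one_ereal_def )
  apply (auto simp: divide_simps split: if_splits)
done

lemma unpolar_polar: "x \<in> pos_quadrant \<Longrightarrow> unpolar (polar x) = x"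
  apply (cases x; cases "fst x"; cases "snd x")
     apply (simp_all add: polar_def unpolar_def Let_def mem_pos_quadrant_iff min_def)
  apply (auto simp: divide_simps split: if_splits)
 done

lemma delta_aleph_ge_1: "\<theta> \<in> delta_aleph \<Longrightarrow> 1 \<le> fst \<theta> \<and> 1 \<le> snd \<theta>"
  by (auto simp: delta_aleph_eq min_def split: if_splits)

lemma min_unpolar: 
  assumes "y \<in> {0<..} \<times> delta_aleph" 
  shows "min (fst (unpolar y)) (snd (unpolar y)) = fst y"
proof (cases "fst (snd y) \<le> snd (snd y)")
  case True
  with assms have "fst (snd y) = 1" "fst y * 1 \<le> fst y * snd (snd y)"
    by (auto simp: delta_aleph_eq min_def simp del: mult_1_right intro!: ereal_mult_left_mono)
  then show ?thesis by (simp add: unpolar_def min_def)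
next
  case False
  with assms have "snd (snd y) = 1" "fst y * 1 \<le> fst y * fst (snd y)"
    by (auto simp: delta_aleph_eq min_def simp del: mult_1_right intro!: ereal_mult_left_mono)
  then show ?thesis by (simp add: unpolar_def min_def)
qed

lemma unpolar_mem: "y \<in> {0<..} \<times> delta_aleph \<Longrightarrow> unpolar y \<in> pos_quadrant"
  using min_unpolar[of y] by (auto simp: mem_pos_quadrant_iff)

text \<open>Multiplication of extended reals fails to be continuous only at products of 0 and
  \<infinity>; here the radius is positive and both angle coordinates are at least 1.\<close>

lemma continuous_on_unpolar: "continuous_on ({0<..} \<times> delta_aleph) unpolar"
  unfolding unpolar_def continuous_on_def
proof (intro ballI tendsto_Pair tendsto_mult_ereal)
  fix y :: "ereal \<times> ereal \<times> ereal" assume y: "y \<in> {0<..} \<times> delta_aleph"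
  show "\<not> (fst y = 0 \<and> \<bar>fst (snd y)\<bar> = \<infinity> \<or> fst (snd y) = 0 \<and> \<bar>fst y\<bar> = \<infinity>)"
    "\<not> (fst y = 0 \<and> \<bar>snd (snd y)\<bar> = \<infinity> \<or> snd (snd y) = 0 \<and> \<bar>fst y\<bar> = \<infinity>)"
    using y delta_aleph_ge_1[of "snd y"] by auto
qed (auto intro!: tendsto_intros)

text \<open>Where the minimum is positive and finite, so is its inverse. The quotients are then
  products away from the indeterminate forms, even when one coordinate is \<infinity>.\<close>

lemma continuous_on_polar: "continuous_on {x \<in> pos_quadrant. min (fst x) (snd x) < \<infinity>} polar"
proof -
  have d: "continuous_on {x \<in> pos_quadrant. min (fst x) (snd x) < \<infinity>} (\<lambda>x. g x / min (fst x) (snd x))"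
    if g: "continuous_on UNIV g" for g :: "ereal \<times> ereal \<Rightarrow> ereal"
    unfolding continuous_on_def divide_ereal_def
  proof (rule ballI)
    fix x :: "ereal \<times> ereal" assume x: "x \<in> {x \<in> pos_quadrant. min (fst x) (snd x) < \<infinity>}"
    let ?S = "{x \<in> pos_quadrant. min (fst x) (snd x) < \<infinity>}"
    have "(g \<longlongrightarrow> g x) (at x within ?S)"
      using continuous_on_subset[OF g subset_UNIV, of ?S] x unfolding continuous_on_def by blast
    moreover have "((\<lambda>x. inverse (min (fst x) (snd x))) \<longlongrightarrow> inverse (min (fst x) (snd x))) (at x within ?S)"
    proof (rule Extended_Real.tendsto_inverse_ereal)
      show "((\<lambda>x. min (fst x) (snd x)) \<longlongrightarrow> min (fst x) (snd x)) (at x within ?S)"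
        by (intro tendsto_intros)
      show "eventually (\<lambda>x. 0 \<le> min (fst x) (snd x)) (at x within ?S)"
        by (auto simp: eventually_at_filter mem_pos_quadrant_iff less_imp_le)
    qed
    moreover have "\<not> (g x = 0 \<and> \<bar>inverse (min (fst x) (snd x))\<bar> = \<infinity> \<or> inverse (min (fst x) (snd x)) = 0 \<and> \<bar>g x\<bar> = \<infinity>)"
      using x by (cases "min (fst x) (snd x)") (auto simp: mem_pos_quadrant_iff simp del: min_less_iff_conj)
    ultimately show "((\<lambda>x. g x * inverse (min (fst x) (snd x))) \<longlongrightarrow> g x * inverse (min (fst x) (snd x))) (at x within ?S)"
      by (rule tendsto_mult_ereal)
  qed
  have "continuous_on {x \<in> pos_quadrant. min (fst x) (snd x) < \<infinity>}
     (\<lambda>x. (min (fst x) (snd x), fst x / min (fst x) (snd x), snd x / min (fst x) (snd x)))"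
    by (intro continuous_on_Pair continuous_on_min continuous_on_fst continuous_on_snd continuous_on_id d)
  then show ?thesis
    by (rule continuous_on_eq) (auto simp: polar_def Let_def)
qed

lemma measurable_polar: "polar \<in> borel_measurable borel"
  unfolding polar_def Let_def borel_prod[symmetric] by measurable

section \<open>Transfer of test functions between the quadrant and the polar space\<close>

lemma ck_plus_comp_unpolar:
  assumes f: "f \<in> ck_plus pos_quadrant"
  shows "(\<lambda>y. f (unpolar y)) \<in> ck_plus ({0<..} \<times> delta_aleph)"
proof -
  obtain K where K: "compact K" "K \<subseteq> pos_quadrant" "\<And>x. x \<in> pos_quadrant - K \<Longrightarrow> f x = 0"
    and c: "continuous_on pos_quadrant f" and nn: "\<And>x. x \<in> pos_quadrant \<Longrightarrow> 0 \<le> f x"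
    using f by (auto simp: ck_plus_def)
  have "compact ((\<lambda>x. min (fst x) (snd x)) ` K)"
    by (intro compact_continuous_image K continuous_intros)
  moreover have "(\<lambda>x. min (fst x) (snd x)) ` K \<subseteq> {0<..}"
    using K(2) by (auto simp: mem_pos_quadrant_iff subset_eq)
  ultimately obtain a where a: "0 < a" "(\<lambda>x. min (fst x) (snd x)) ` K \<subseteq> {a..}"
    by (rule compact_ereal_bounded_below)
  \<comment> \<open>Properness enters here: the radius of y is the minimum of
    \<open>unpolar y\<close>, so a radius below a puts the image outside K. What remains is a
    product of two compact sets.\<close>
  have "f (unpolar y) = 0" if "y \<in> {0<..} \<times> delta_aleph - {a..} \<times> delta_aleph" for y
  proof -
    have "unpolar y \<notin> K"
    proof
      assume "unpolar y \<in> K"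
      with a(2) have "min (fst (unpolar y)) (snd (unpolar y)) \<in> {a..}" by blast
      with that min_unpolar[of y] show False by auto
    qed
    then show ?thesis using K(3) unpolar_mem[of y] that by auto
  qed
  moreover have "continuous_on ({0<..} \<times> delta_aleph) (\<lambda>y. f (unpolar y))"
    by (rule continuous_on_compose2[OF c continuous_on_unpolar]) (auto intro: unpolar_mem)
  moreover have "compact ({a..} \<times> delta_aleph)"
    by (intro compact_Times compact_atLeast_ereal compact_delta_aleph)
  ultimately show ?thesis
    using a(1) nn unpolar_mem unfolding ck_plus_def
    by (auto intro!: exI[of _ "{a..} \<times> delta_aleph"])
qed

text \<open>For positive r this is 1 up to t, 0 from 2 t on, and linear in between. The inner
  minimum with 2 t matters at \<infinity>, where \<open>real_of_ereal\<close> would return 0 and the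
  cutoff would wrongly be 1.\<close>

definition cutoff :: "real \<Rightarrow> ereal \<Rightarrow> real" where
  "cutoff t r = max 0 (min 1 (2 - real_of_ereal (min r (ereal (2 * t))) / t))"

lemma cutoff_bounds: "0 \<le> cutoff t r" "cutoff t r \<le> 1"
  by (auto simp: cutoff_def)

lemma cutoff_eq_1: "0 < t \<Longrightarrow> 0 < r \<Longrightarrow> r \<le> ereal t \<Longrightarrow> cutoff t r = 1"
  by (cases r) (auto simp: cutoff_def min_def field_simps)

lemma cutoff_eq_0: "0 < t \<Longrightarrow> ereal (2 * t) \<le> r \<Longrightarrow> cutoff t r = 0"
  by (auto simp: cutoff_def min_def)

lemma continuous_on_cutoff:
  assumes "0 < t" shows "continuous_on {0<..} (cutoff t)"
proof -
  have "continuous_on {0<..} (\<lambda>r. min r (ereal (2 * t)))"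
    by (intro continuous_on_min continuous_on_id continuous_on_const)
  then have "continuous_on {0<..} (\<lambda>r. real_of_ereal (min r (ereal (2 * t))))"
    by (rule continuous_on_compose2[OF continuous_on_real]) (auto simp: min_def_raw split: if_splits)
  then show ?thesis unfolding cutoff_def using assms
    by (intro continuous_intros) auto
qed

text \<open>Continuity is glued from two open sets covering the quadrant: \<open>polar\<close> is
  continuous where the minimum is finite, and the product is identically 0 where the minimum exceeds
  2 t. The second set contains the corner.\<close>

lemma ck_plus_cutoff_polar:
  assumes f: "f \<in> ck_plus ({0<..} \<times> delta_aleph)" and t: "0 < t"
  shows "(\<lambda>x. cutoff t (min (fst x) (snd x)) * f (polar x)) \<in> ck_plus pos_quadrant"
proof -
  let ?F = "{0<..} \<times> delta_aleph"
  let ?m = "\<lambda>x::ereal \<times> ereal. min (fst x) (snd x)"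
  let ?h = "\<lambda>x. cutoff t (?m x) * f (polar x)"
  obtain K where K: "compact K" "K \<subseteq> ?F" "\<And>x. x \<in> ?F - K \<Longrightarrow> f x = 0"
    and c: "continuous_on ?F f" and nn: "\<And>x. x \<in> ?F \<Longrightarrow> 0 \<le> f x"
    using f by (auto simp: ck_plus_def)
  have "compact (fst ` K)" by (intro compact_continuous_image K continuous_intros)
  moreover have "fst ` K \<subseteq> {0<..}" using K(2) by auto
  ultimately obtain a where a: "0 < a" "fst ` K \<subseteq> {a..}"
    by (rule compact_ereal_bounded_below)
  have fin: "{x \<in> pos_quadrant. ?m x < \<infinity>} = pos_quadrant \<inter> ?m -` {..<\<infinity>}" by auto
  have "continuous_on {x \<in> pos_quadrant. ?m x < \<infinity>} ?h"
  proof (intro continuous_on_mult)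
    show "continuous_on {x \<in> pos_quadrant. ?m x < \<infinity>} (\<lambda>x. cutoff t (?m x))"
      by (rule continuous_on_compose2[OF continuous_on_cutoff[OF t]])
         (auto intro!: continuous_intros simp: mem_pos_quadrant_iff)
    show "continuous_on {x \<in> pos_quadrant. ?m x < \<infinity>} (\<lambda>x. f (polar x))"
      by (rule continuous_on_compose2[OF c continuous_on_polar]) (use polar_mem in blast)
  qed
  moreover have "continuous_on {x \<in> pos_quadrant. ereal (2 * t) < ?m x} ?h"
    by (rule continuous_on_eq[OF continuous_on_const[of _ 0]]) (simp add: cutoff_eq_0[OF t less_imp_le] del: min_less_iff_conj)
  moreover have "open {x \<in> pos_quadrant. ?m x < \<infinity>}" "open {x \<in> pos_quadrant. ereal (2 * t) < ?m x}"
    by (intro open_Collect_conj open_Collect_less continuous_intros; simp add: open_pos_quadrant)+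
  ultimately have "continuous_on ({x \<in> pos_quadrant. ?m x < \<infinity>} \<union> {x \<in> pos_quadrant. ereal (2 * t) < ?m x}) ?h"
    by (intro continuous_on_open_Un)
  moreover have "{x \<in> pos_quadrant. ?m x < \<infinity>} \<union> {x \<in> pos_quadrant. ereal (2 * t) < ?m x} = pos_quadrant"
    by (auto simp: min_def_raw split: if_splits)
  ultimately have "continuous_on pos_quadrant ?h" by simp
  moreover have "?h x = 0" if "x \<in> pos_quadrant - {a..} \<times> {a..}" for x
  proof -
    have "\<not> a \<le> fst (polar x)" using that by (cases x) (auto simp: fst_polar)
    then have "polar x \<notin> K" using a(2) by auto
    then show ?thesis using K(3) polar_mem[of x] that by auto
  qed
  moreover have "compact ({a..} \<times> {a..})" by (intro compact_Times compact_atLeast_ereal)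
  moreover have "{a..} \<times> {a..} \<subseteq> pos_quadrant" using a(1) by (auto simp: pos_quadrant_def)
  ultimately show ?thesis
    using nn polar_mem cutoff_bounds(1) unfolding ck_plus_def
    by (auto intro!: exI[of _ "{a..} \<times> {a..}"] mult_nonneg_nonneg)
qed

section \<open>The standardized hidden measure has no atom at infinity\<close>

lemma scale_measure_eq_density: "scale_measure r M = density M (\<lambda>_. r)"
  by (rule measure_eqI) (simp_all add: emeasure_density_const)

lemma sets_scaled_image: "sets (scaled_image F r D T) = sets (restrict_space borel F)"
  by (simp add: scaled_image_def sets_restrict_space)

lemma integral_scaled_image:
  fixes f :: "'b::topological_space \<Rightarrow> real"
  assumes r: "0 \<le> r" and F: "F \<in> sets borel" and T: "T \<in> borel_measurable D"
    and f: "f \<in> borel_measurable (restrict_space borel F)"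
  shows "(\<integral>x. f x \<partial>scaled_image F r D T) = r * (\<integral>\<omega>. indicator F (T \<omega>) * f (T \<omega>) \<partial>D)"
proof -
  let ?R = "restrict_space (distr D borel T) F"
  have sR: "sets ?R = sets (restrict_space borel F)" by (simp add: sets_restrict_space)
  have fR: "f \<in> borel_measurable ?R" using f by (simp add: measurable_cong_sets[OF sR refl])
  have "(\<integral>x. f x \<partial>scaled_image F r D T) = (\<integral>x. r * f x \<partial>?R)"
    unfolding scaled_image_def scale_measure_eq_density
    using r fR by (subst integral_density) auto
  also have "\<dots> = r * (\<integral>x. f x \<partial>?R)" by simp
  also have "(\<integral>x. f x \<partial>?R) = (\<integral>x. indicator F x * f x \<partial>distr D borel T)"
    using F by (subst integral_restrict_space) auto
  also have "\<dots> = (\<integral>\<omega>. indicator F (T \<omega>) * f (T \<omega>) \<partial>D)"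
  proof (rule integral_distr[OF T])
    show "(\<lambda>x. indicator F x * f x) \<in> borel_measurable borel"
      using f F by (subst (asm) borel_measurable_restrict_space_iff) auto
  qed
  finally show ?thesis .
qed

lemma min_divide_ereal:
  assumes "0 < c" shows "min (a / ereal c) (b / ereal c) = min a b / ereal c"
  using ereal_divide_right_mono[of a b "ereal c"] ereal_divide_right_mono[of b a "ereal c"] assms
  by (auto simp: min_def intro: antisym)

lemma divide_divide_ereal:
  "0 < a \<Longrightarrow> 0 < b \<Longrightarrow> r / ereal a / ereal b = r / ereal (b * a)"
  by (cases r) (simp_all add: field_simps)

lemma cutoff_scale:
  assumes "0 < c" "0 < t" shows "cutoff (c * t) r = cutoff t (r / ereal c)"
  using assms by (cases r) (auto simp: cutoff_def min_def field_simps)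

text \<open>Makes \<open>1 - cutoff\<close> vanish off the quadrant too, so that an integral of it
  is unchanged when mass outside \<open>pos_quadrant\<close> is discarded.\<close>

lemma cutoff_nonpos: "0 < t \<Longrightarrow> r \<le> 0 \<Longrightarrow> cutoff t r = 1"
  by (cases r) (auto simp: cutoff_def min_def field_simps)

text \<open>A tail function has compact support here because {t..} \<times> {t..} is compact once
  the points at infinity are included.\<close>

lemma ck_plus_tail:
  assumes t: "0 < t"
  shows "(\<lambda>x. 1 - cutoff t (min (fst x) (snd x))) \<in> ck_plus pos_quadrant"
proof -
  have "continuous_on pos_quadrant (\<lambda>x. cutoff t (min (fst x) (snd x)))"
    by (rule continuous_on_compose2[OF continuous_on_cutoff[OF t]])
       (auto intro!: continuous_intros simp: mem_pos_quadrant_iff)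
  moreover have "compact ({ereal t..} \<times> {ereal t..})" by (intro compact_Times compact_atLeast_ereal)
  moreover have "{ereal t..} \<times> {ereal t..} \<subseteq> pos_quadrant"
    using t by (auto simp: pos_quadrant_def intro: less_le_trans[of 0 "ereal t"])
  moreover have "1 - cutoff t (min (fst x) (snd x)) = 0" if "x \<in> pos_quadrant - {ereal t..} \<times> {ereal t..}" for x
    using that by (cases x) (auto intro!: cutoff_eq_1[OF t] simp: mem_pos_quadrant_iff min_le_iff_disj)
  ultimately show ?thesis using cutoff_bounds(2)
    unfolding ck_plus_def
    by (auto intro!: exI[of _ "{ereal t..} \<times> {ereal t..}"] continuous_intros)
qed

lemma borel_measurable_U2:
  assumes "prob_space D" "sets D = sets borel"
  shows "U2 D \<in> borel_measurable borel"
proof -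
  interpret D: prob_space D by fact
  have m: "(\<lambda>(x1, x2). min x1 x2) \<in> D \<rightarrow>\<^sub>M (borel :: real measure)"
    unfolding measurable_cong_sets[OF assms(2) refl] borel_prod[symmetric] by measurable
  interpret Z: real_distribution "distr D borel (\<lambda>(x1, x2). min x1 x2)"
    using D.prob_space_distr[OF m] by (simp add: real_distribution_def real_distribution_axioms_def)
  have "mono (min_df D)"
    unfolding min_df_def by (intro monoI Z.cdf_nondecreasing)
  then have [measurable]: "min_df D \<in> borel_measurable borel"
    by (rule borel_measurable_mono)
  show ?thesis unfolding U2_def[abs_def] by measurable
qed

text \<open>Comparing the converging sequence with its subsequence of the indices \<open>N n\<close> shows that the tail
  integral at \<open>1\<close> is \<open>N\<close> times the tail integral at \<open>N\<close>, so it bounds \<open>N\<close> times the mass of the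
  atom.\<close>

lemma standardized_hidden_measure_infinity:
  assumes D: "prob_space D" "sets D = sets borel" and \<nu>t: "standardized_hidden_measure D \<nu>t"
  shows "{(\<infinity>, \<infinity>)} \<in> null_sets \<nu>t"
proof -
  have lim: "vaguely_converges pos_quadrant (\<lambda>n. scaled_image pos_quadrant (real n) D
       (\<lambda>(x1, x2). (U2 D x1 / ereal (real n), U2 D x2 / ereal (real n)))) \<nu>t"
    using \<nu>t by (simp add: standardized_hidden_measure_def)
  have \<nu>: "\<nu>t \<in> radon_measures pos_quadrant"
    using limitin_topspace[OF lim[unfolded vaguely_converges_def]] by (simp add: topspace_vague_topology)
  then have s: "sets \<nu>t = sets (restrict_space borel pos_quadrant)" by (simp add: radon_measures_def)
  let ?m = "\<lambda>x::ereal \<times> ereal. min (fst x) (snd x)"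
  let ?p = "(\<infinity>, \<infinity>) :: ereal \<times> ereal"
  \<comment> \<open>A continuous substitute for the indicator of a tail. It is nonnegative and
    equals 1 at the corner for every positive t, so it dominates the indicator of that
    point.\<close>
  define h where "h t x = 1 - cutoff t (?m x)" for t x
  have h: "h t \<in> ck_plus pos_quadrant" if "0 < t" for t
    using ck_plus_tail[OF that] by (simp add: h_def[abs_def])
  have int: "(\<integral>x. h t x \<partial>scaled_image pos_quadrant (real n) D
       (\<lambda>(x1, x2). (U2 D x1 / ereal (real n), U2 D x2 / ereal (real n))))
     = real n * (\<integral>x. 1 - cutoff t (min (U2 D (fst x)) (U2 D (snd x)) / ereal (real n)) \<partial>D)"
    if t: "0 < t" and n: "0 < n" for t n
  proof -
    have T: "(\<lambda>(x1, x2). (U2 D x1 / ereal (real n), U2 D x2 / ereal (real n))) \<in> borel_measurable D"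
      using borel_measurable_U2[OF D]
      unfolding measurable_cong_sets[OF D(2) refl] borel_prod[symmetric] by measurable
    have ind: "indicator pos_quadrant x * h t x = h t x" for x
      using cutoff_nonpos[OF t, of "?m x"]
      by (auto simp: h_def indicator_def mem_pos_quadrant_iff not_less simp del: min_less_iff_conj)
    have hm: "h t \<in> borel_measurable (restrict_space borel pos_quadrant)"
      using ck_plus_measurable[OF h[OF t]] by simp
    show ?thesis
      unfolding integral_scaled_image[OF of_nat_0_le_iff borel_open[OF open_pos_quadrant] T hm] ind
      using n by (simp add: case_prod_beta h_def min_divide_ereal)
  qed
  have scale: "(\<integral>x. h 1 x \<partial>\<nu>t) = real N * (\<integral>x. h (real N) x \<partial>\<nu>t)" if N: "0 < N" for N :: nat
  proof (rule LIMSEQ_unique)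
    let ?I = "\<lambda>t n. (\<integral>x. h t x \<partial>scaled_image pos_quadrant (real n) D
       (\<lambda>(x1, x2). (U2 D x1 / ereal (real n), U2 D x2 / ereal (real n))))"
    \<comment> \<open>Threshold N at index \<open>Suc n\<close> and threshold 1 at index
      \<open>N * Suc n\<close> describe the same event scale, and the prefactors differ by N.
      \<open>Suc\<close> excludes index 0, where the normalization would divide by 0.\<close>
    have sm: "strict_mono (\<lambda>n. N * Suc n)" using N by (auto intro!: strict_monoI)
    show "(\<lambda>n. ?I 1 (N * Suc n)) \<longlonglongrightarrow> (\<integral>x. h 1 x \<partial>\<nu>t)"
      using LIMSEQ_subseq_LIMSEQ[OF vaguely_converges_integral[OF lim h] sm] by (simp add: o_def)
    have "(\<lambda>n. real N * ?I (real N) (Suc n)) \<longlonglongrightarrow> real N * (\<integral>x. h (real N) x \<partial>\<nu>t)"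
      using N by (intro tendsto_intros LIMSEQ_Suc vaguely_converges_integral[OF lim h]) auto
    moreover have "real N * ?I (real N) (Suc n) = ?I 1 (N * Suc n)" for n
    proof -
      have cut: "cutoff (real N) (r / ereal (real (Suc n))) = cutoff 1 (r / ereal (real (N * Suc n)))" for r
      proof -
        have "r / ereal (real (Suc n)) / ereal (real N) = r / ereal (real (N * Suc n))"
          unfolding of_nat_mult by (rule divide_divide_ereal) (use N in simp_all)
        moreover have "cutoff (real N * 1) (r / ereal (real (Suc n))) = cutoff 1 (r / ereal (real (Suc n)) / ereal (real N))"
          by (rule cutoff_scale) (use N in simp_all)
        ultimately show ?thesis by (simp only: mult_1_right)
      qed
      have "real N * ?I (real N) (Suc n) = real N * (real (Suc n) *
          (\<integral>x. 1 - cutoff (real N) (min (U2 D (fst x)) (U2 D (snd x)) / ereal (real (Suc n))) \<partial>D))"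
        using N by (subst int) simp_all
      also have "\<dots> = real (N * Suc n) *
          (\<integral>x. 1 - cutoff 1 (min (U2 D (fst x)) (U2 D (snd x)) / ereal (real (N * Suc n))) \<partial>D)"
        by (simp only: cut of_nat_mult mult.assoc)
      also have "\<dots> = ?I 1 (N * Suc n)"
        by (rule int[symmetric]) (use N in simp_all)
      finally show ?thesis .
    qed
    ultimately show "(\<lambda>n. ?I 1 (N * Suc n)) \<longlonglongrightarrow> real N * (\<integral>x. h (real N) x \<partial>\<nu>t)" by simp
  qed
  have p: "{?p} \<subseteq> pos_quadrant" by (simp add: pos_quadrant_def)
  then have pm: "{?p} \<in> sets \<nu>t"
    unfolding s by (subst sets_restrict_space_iff) (simp_all add: borel_open[OF open_pos_quadrant])
  have fin: "emeasure \<nu>t {?p} < \<infinity>"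
    using \<nu> p compact_insert[OF compact_empty, of ?p] unfolding radon_measures_def by blast
  have "real N * measure \<nu>t {?p} \<le> (\<integral>x. h 1 x \<partial>\<nu>t)" for N :: nat
  proof (cases "N = 0")
    case True
    have "0 \<le> (\<integral>x. h 1 x \<partial>\<nu>t)"
      by (rule integral_nonneg_AE) (simp add: h_def cutoff_bounds(2))
    with True show ?thesis by simp
  next
    case False
    have "measure \<nu>t {?p} = (\<integral>x. indicator {?p} x \<partial>\<nu>t)" using pm fin by simp
    also have "\<dots> \<le> (\<integral>x. h (real N) x \<partial>\<nu>t)"
    proof (rule integral_mono)
      show "integrable \<nu>t (indicator {?p} :: _ \<Rightarrow> real)" using pm fin by (rule integrable_real_indicator)
      show "integrable \<nu>t (h (real N))" using False by (intro ck_plus_integrable[OF h \<nu>]) simp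
      show "indicator {?p} x \<le> h (real N) x" for x
      proof (cases "x = ?p")
        case True
        then show ?thesis using cutoff_eq_0[of "real N" "\<infinity>"] False by (simp add: h_def)
      qed (simp add: h_def cutoff_bounds(2))
    qed
    finally have "real N * measure \<nu>t {?p} \<le> real N * (\<integral>x. h (real N) x \<partial>\<nu>t)"
      by (rule mult_left_mono) simp
    also have "\<dots> = (\<integral>x. h 1 x \<partial>\<nu>t)" using scale[of N] False by simp
    finally show ?thesis .
  qed
  then have "\<not> 0 < measure \<nu>t {?p}"
    using reals_Archimedean3[of "measure \<nu>t {?p}"] by (meson not_le)
  then have "measure \<nu>t {?p} = 0"
    using measure_nonneg[of \<nu>t "{?p}"] by linarith
  then show ?thesis
    using pm fin by (simp add: null_sets_def emeasure_eq_ennreal_measure)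
qed

section \<open>The hidden measure in polar coordinates\<close>

lemma sets_nu1: "sets nu1 = sets (restrict_space borel {0<..})"
  by (simp add: nu1_def sets_restrict_space)

lemma space_nu1: "space nu1 = {0<..}"
  by (simp add: nu1_def space_restrict_space)

text \<open>Closed tails are the form in which the spectral measure is specified, through
  \<open>min x1 x2 \<ge> ereal r\<close>.\<close>

lemma nu1_atLeast:
  assumes "y > 0"
  shows "emeasure nu1 {ereal y..} = ennreal (1 / y)"
proof -
  have "emeasure nu1 {ereal y..}
      = emeasure (distr (restrict_space lborel {0<..}) borel (\<lambda>t. ereal (1 / t))) {ereal y..}"
    using assms unfolding nu1_def by (subst emeasure_restrict_space) (auto simp: less_le_trans[of 0 "ereal y"])
  also have "\<dots> = emeasure (restrict_space lborel {0<..}) ((\<lambda>t. ereal (1 / t)) -` {ereal y..} \<inter> {0<..})"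
    by (subst emeasure_distr) (auto simp: space_restrict_space intro!: measurable_restrict_space1)
  also have "(\<lambda>t. ereal (1 / t)) -` {ereal y..} \<inter> {0<..} = {0<..1 / y}"
    using assms by (auto simp: field_simps)
  also have "emeasure (restrict_space lborel {0<..}) {0<..1 / y} = ennreal (1 / y)"
    using assms by (subst emeasure_restrict_space) auto
  finally show ?thesis .
qed

text \<open>The generator has only finite endpoints. Complements of its members give the points
  below a real r; the set of all finite points is the complement of {\<infinity>}, which is the
  intersection of the tails at the positive integers.\<close>

lemma sets_ereal_positive:
  "sets (restrict_space borel {0<..}) = sigma_sets {0<..} {{ereal r..} | r. 0 < r}" (is "_ = sigma_sets ?\<Omega> ?E")
proof (rule antisym)
  have E: "?E \<subseteq> Pow ?\<Omega>" by (auto intro: less_le_trans[of 0 "ereal _"])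
  have top: "{\<infinity>} \<in> sets (sigma ?\<Omega> ?E)"
  proof -
    have "(\<Inter>n. {ereal (real (Suc n))..}) \<in> sets (sigma ?\<Omega> ?E)"
      using E by (intro sets.countable_INT) (auto intro!: sigma_sets.Basic)
    also have "(\<Inter>n. {ereal (real (Suc n))..}) = {\<infinity>}"
    proof -
      have "x = \<infinity>" if x: "\<And>n. ereal (real (Suc n)) \<le> x" for x
      proof (cases x)
        case (real r)
        obtain n where "r < real n" using reals_Archimedean2 by blast
        with x[of n] real show ?thesis by simp
      qed (use x[of 0] in auto)
      then show ?thesis by auto
    qed
    finally show ?thesis .
  qed
  show "sets (restrict_space borel ?\<Omega>) \<subseteq> sigma_sets ?\<Omega> ?E"
  proof
    fix B assume "B \<in> sets (restrict_space borel ?\<Omega>)"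
    then obtain A where A: "A \<in> sets borel" "B = ?\<Omega> \<inter> A" by (auto simp: sets_restrict_space)
    from A(1) have "A \<in> sigma_sets UNIV (range lessThan)" unfolding borel_Iio by simp
    then have "?\<Omega> \<inter> A \<in> sets (sigma ?\<Omega> ?E)"
    proof induction
      case (Basic a)
      then obtain x where x: "a = {..<x}" by auto
      consider "x \<le> 0" | "x = \<infinity>" | r where "0 < r" "x = ereal r" by (cases x) force+
      then show ?case
      proof cases
        case 1
        then have "?\<Omega> \<inter> a = {}" by (auto simp: x)
        then show ?thesis by simp
      next
        case 2
        then have "?\<Omega> \<inter> a = space (sigma ?\<Omega> ?E) - {\<infinity>}" using E by (auto simp: x space_measure_of)
        then show ?thesis using top by (simp add: sets.compl_sets)
      next
        case 3
        then have "?\<Omega> \<inter> a = space (sigma ?\<Omega> ?E) - {ereal r..}" using E by (auto simp: x space_measure_of)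
        moreover have "{ereal r..} \<in> sets (sigma ?\<Omega> ?E)" using 3 E by (auto intro!: sigma_sets.Basic)
        ultimately show ?thesis by (simp add: sets.compl_sets)
      qed
    next
      case Empty show ?case by simp
    next
      case (Compl a)
      have "?\<Omega> \<inter> (UNIV - a) = ?\<Omega> - (?\<Omega> \<inter> a)" by auto
      then show ?case using sets.compl_sets[OF Compl.IH] E by simp
    next
      case (Union a)
      have "?\<Omega> \<inter> \<Union> (range a) = (\<Union>i. ?\<Omega> \<inter> a i)" by auto
      then show ?case using Union.IH by (simp only:) (intro sets.countable_UN, auto)
    qed
    then show "B \<in> sigma_sets ?\<Omega> ?E" using A E by simp
  qed
  show "sigma_sets ?\<Omega> ?E \<subseteq> sets (restrict_space borel ?\<Omega>)"
  proof (rule sets.sigma_sets_subset[of _ "restrict_space borel ?\<Omega>", simplified space_restrict_space, simplified])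
    show "?E \<subseteq> sets (restrict_space borel ?\<Omega>)"
      using E by (subst subset_iff) (auto simp: sets_restrict_space_iff)
  qed
qed

lemma positive_ereal_cover: "(\<Union>i. {ereal (1 / real (Suc i))..}) = {0<..}"
proof (intro set_eqI iffI)
  fix x :: ereal assume "x \<in> {0<..}"
  then obtain r where r: "0 < ereal r" "ereal r < x" using ereal_dense2[of 0 x] by auto
  then obtain n where "1 / real (Suc n) < r" using nat_approx_posE[of r] by auto
  then have "ereal (1 / real (Suc n)) < x" using r by (auto intro: less_trans[of _ "ereal r"])
  then show "x \<in> (\<Union>i. {ereal (1 / real (Suc i))..})" by (auto intro!: exI[of _ n])
next
  fix x :: ereal assume "x \<in> (\<Union>i. {ereal (1 / real (Suc i))..})"
  then obtain i where "ereal (1 / real (Suc i)) \<le> x" by auto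
  moreover have "0 < ereal (1 / real (Suc i))" by simp
  ultimately show "x \<in> {0<..}" by (metis greaterThan_iff less_le_trans)
qed

lemma sigma_finite_nu1: "sigma_finite_measure nu1"
proof
  let ?A = "range (\<lambda>i. {ereal (1 / real (Suc i))..})"
  have "?A \<subseteq> sets nu1"
    unfolding sets_nu1 sets_ereal_positive by (auto intro!: sigma_sets.Basic)
  moreover have "\<Union> ?A = space nu1" using positive_ereal_cover by (simp add: space_nu1)
  moreover have "emeasure nu1 a \<noteq> \<infinity>" if "a \<in> ?A" for a
    using that by (auto simp: nu1_atLeast)
  ultimately show "\<exists>A. countable A \<and> A \<subseteq> sets nu1 \<and> \<Union> A = space nu1 \<and> (\<forall>a\<in>A. emeasure nu1 a \<noteq> \<infinity>)"
    by (intro exI[of _ ?A]) auto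
qed

text \<open>Each inclusion is measurability of the identity in one direction. Second countability
  identifies the Borel sets of the product space with the product sigma-algebra.\<close>

lemma sets_pair_restrict_borel:
  fixes A :: "'b::second_countable_topology set" and B :: "'c::second_countable_topology set"
  shows "sets (restrict_space borel A \<Otimes>\<^sub>M restrict_space borel B) = sets (restrict_space borel (A \<times> B))"
proof (rule antisym)
  have sp: "space (restrict_space borel A \<Otimes>\<^sub>M restrict_space borel B) = A \<times> B"
    by (simp add: space_pair_measure space_restrict_space)
  have "(\<lambda>x. x) \<in> (restrict_space borel A \<Otimes>\<^sub>M restrict_space borel B) \<rightarrow>\<^sub>M restrict_space borel (A \<times> B)"
  proof (rule measurable_restrict_space2)
    have "(\<lambda>x. (fst x, snd x)) \<in> (restrict_space borel A \<Otimes>\<^sub>M restrict_space borel B) \<rightarrow>\<^sub>M (borel \<Otimes>\<^sub>M borel)"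
      by (intro measurable_Pair measurable_compose[OF measurable_fst] measurable_compose[OF measurable_snd]
          measurable_restrict_space1 measurable_ident_sets) simp_all
    then show "(\<lambda>x. x) \<in> (restrict_space borel A \<Otimes>\<^sub>M restrict_space borel B) \<rightarrow>\<^sub>M borel"
      by (simp add: borel_prod)
  qed (simp add: sp)
  from measurable_sets[OF this]
  show "sets (restrict_space borel (A \<times> B)) \<subseteq> sets (restrict_space borel A \<Otimes>\<^sub>M restrict_space borel B)"
    using sets.sets_into_space by (fastforce simp: sp space_restrict_space vimage_def Int_absorb2)
  have "(\<lambda>x. (fst x, snd x)) \<in> restrict_space borel (A \<times> B) \<rightarrow>\<^sub>M (restrict_space borel A \<Otimes>\<^sub>M restrict_space borel B)"
  proof (intro measurable_Pair measurable_restrict_space2)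
    show "fst \<in> restrict_space borel (A \<times> B) \<rightarrow>\<^sub>M borel" "snd \<in> restrict_space borel (A \<times> B) \<rightarrow>\<^sub>M borel"
      by (intro measurable_restrict_space1; simp add: borel_prod[symmetric])+
  qed (auto simp: space_restrict_space)
  from measurable_sets[OF this]
  show "sets (restrict_space borel A \<Otimes>\<^sub>M restrict_space borel B) \<subseteq> sets (restrict_space borel (A \<times> B))"
    using sets.sets_into_space[of _ "restrict_space borel A \<Otimes>\<^sub>M restrict_space borel B"]
    by (fastforce simp: sp space_restrict_space vimage_def Int_absorb2)
qed


lemma measurable_polar_restrict:
  assumes "sets \<nu> = sets (restrict_space borel pos_quadrant)"
  shows "polar \<in> \<nu> \<rightarrow>\<^sub>M restrict_space borel ({0<..} \<times> delta_aleph)"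
  unfolding measurable_cong_sets[OF assms refl]
  by (intro measurable_restrict_space2 measurable_restrict_space1 measurable_polar)
     (use polar_mem in \<open>auto simp: space_restrict_space\<close>)

text \<open>A product of sigma-finite measures is determined by rectangles. For a fixed set B of
  angles both sides are measures in the radial set; they agree on closed tails by the definition of
  \<open>S0\<close>, and these tails form an intersection-stable generator with a cover by sets of
  finite mass.\<close>

lemma polar_pushforward:
  assumes \<nu>t: "\<nu>t \<in> radon_measures pos_quadrant" and inf: "{(\<infinity>, \<infinity>)} \<in> null_sets \<nu>t"
    and S0: "hidden_spectral_measure \<nu>t S0"
  shows "nu1 \<Otimes>\<^sub>M S0 = distr \<nu>t (restrict_space borel ({0<..} \<times> delta_aleph)) polar"
proof -
  let ?F = "{0<..} \<times> delta_aleph :: (ereal \<times> ereal \<times> ereal) set"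
  let ?P = "distr \<nu>t (restrict_space borel ?F) polar"
  let ?E = "{{ereal r..} | r. 0 < r}"
  have s\<nu>: "sets \<nu>t = sets (restrict_space borel pos_quadrant)" using \<nu>t by (simp add: radon_measures_def)
  have sp\<nu>: "space \<nu>t = pos_quadrant" using sets_eq_imp_space_eq[OF s\<nu>] by (simp add: space_restrict_space)
  have sS: "sets S0 = sets (restrict_space borel delta_aleph)" and "prob_space S0"
    and spec: "\<And>r \<Lambda>. r > 0 \<Longrightarrow> \<Lambda> \<in> sets (restrict_space borel delta_aleph) \<Longrightarrow>
        emeasure \<nu>t {(x1, x2). (x1, x2) \<in> pos_quadrant \<and> min x1 x2 \<ge> ereal r \<and>
                        (x1 / min x1 x2, x2 / min x1 x2) \<in> \<Lambda>}
          = ennreal (1 / r) * emeasure S0 \<Lambda>"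
    using S0 by (auto simp: hidden_spectral_measure_def)
  interpret S0: prob_space S0 by fact
  have pm: "polar \<in> \<nu>t \<rightarrow>\<^sub>M restrict_space borel ?F"
    by (rule measurable_polar_restrict[OF s\<nu>])
  have sets: "sets (nu1 \<Otimes>\<^sub>M S0) = sets (restrict_space borel ?F)"
    using sets_pair_measure_cong[OF sets_nu1 sS]
    by (simp add: sets_pair_restrict_borel)
  have tail: "emeasure ?P ({ereal r..} \<times> B) = ennreal (1 / r) * emeasure S0 B"
    if r: "0 < r" and B: "B \<in> sets S0" for r B
  proof -
    let ?A = "polar -` ({ereal r..} \<times> B) \<inter> space \<nu>t"
    have "{ereal r..} \<in> sets nu1" unfolding sets_nu1 sets_ereal_positive using r by (auto intro!: sigma_sets.Basic)
    then have RB: "{ereal r..} \<times> B \<in> sets (restrict_space borel ?F)"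
      unfolding sets[symmetric] using B by (rule pair_measureI)
    have Bd: "B \<subseteq> delta_aleph" using B sets.sets_into_space[OF B] sets_eq_imp_space_eq[OF sS] by (simp add: space_restrict_space)
    \<comment> \<open>At the corner the quotients evaluate to (0, 0), which is not an angle, while
      \<open>polar\<close> assigns (1, 1). The two sets can differ only there, at a null
      point.\<close>
    have "{(x1, x2). (x1, x2) \<in> pos_quadrant \<and> min x1 x2 \<ge> ereal r \<and> (x1 / min x1 x2, x2 / min x1 x2) \<in> B}
        = ?A - {(\<infinity>, \<infinity>)}"
    proof -
      have "(0, 0) \<notin> B" using Bd by (auto simp: delta_aleph_eq)
      moreover have "min x1 x2 = \<infinity> \<longleftrightarrow> x1 = \<infinity> \<and> x2 = \<infinity>" for x1 x2 :: ereal
        by (auto simp: min_def)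
      ultimately show ?thesis
        by (auto simp: sp\<nu> polar_def Let_def zero_prod_def simp del: min_le_iff_disj min.bounded_iff split: if_splits)
    qed
    moreover have "?A \<in> sets \<nu>t" by (rule measurable_sets[OF pm RB])
    ultimately show ?thesis
      using spec[OF r, of B] B emeasure_Diff_null_set[OF inf, of ?A]
      by (simp add: emeasure_distr[OF pm RB] sS)
  qed
  show ?thesis
  proof (rule pair_measure_eqI[OF sigma_finite_nu1])
    show "sigma_finite_measure S0" by (rule S0.sigma_finite_measure_axioms)
    show "sets (nu1 \<Otimes>\<^sub>M S0) = sets ?P" using sets by simp
    fix A B assume A: "A \<in> sets nu1" and B: "B \<in> sets S0"
    have RB: "A \<times> B \<in> sets ?P" if "A \<in> sets nu1" for A
      using pair_measureI[OF that B] by (simp add: sets)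
    have fm: "fst \<in> ?P \<rightarrow>\<^sub>M nu1"
      using measurable_cong_sets[OF sets[symmetric] refl, of nu1] measurable_cong_sets[OF sets_distr[of \<nu>t "restrict_space borel ?F" polar] refl, of nu1]
         measurable_fst[of nu1 S0] by simp
    have spB: "UNIV \<times> B \<inter> ?F \<in> sets ?P"
    proof -
      have "UNIV \<times> B \<inter> ?F = {0<..} \<times> B"
        using sets.sets_into_space[OF B] sets_eq_imp_space_eq[OF sS] by (auto simp: space_restrict_space)
      then show ?thesis using RB[OF sets.top] by (simp only: space_nu1)
    qed
    \<comment> \<open>Turns \<open>A \<mapsto> emeasure ?P (A \<times> B)\<close> into a measure, by
      restricting to angles in B and projecting to the radius, so that uniqueness on a generator
      applies.\<close>
    define Q where "Q = distr (restrict_space ?P (UNIV \<times> B \<inter> ?F)) nu1 fst"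
    have Q: "emeasure Q A = emeasure ?P (A \<times> B)" if A: "A \<in> sets nu1" for A
    proof -
      have "A \<subseteq> {0<..}" using sets.sets_into_space[OF A] by (simp add: space_nu1)
      moreover have "B \<subseteq> delta_aleph"
        using sets.sets_into_space[OF B] sets_eq_imp_space_eq[OF sS] by (simp add: space_restrict_space)
      ultimately have eq: "fst -` A \<inter> space (restrict_space ?P (UNIV \<times> B \<inter> ?F)) = A \<times> B"
        by (auto simp: space_restrict_space)
      have "emeasure Q A = emeasure (restrict_space ?P (UNIV \<times> B \<inter> ?F)) (A \<times> B)"
        unfolding Q_def eq[symmetric] by (rule emeasure_distr[OF measurable_restrict_space1[OF fm] A])
      also have "\<dots> = emeasure ?P (A \<times> B)"
        using spB \<open>A \<subseteq> {0<..}\<close> \<open>B \<subseteq> delta_aleph\<close> by (subst emeasure_restrict_space) auto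
      finally show ?thesis .
    qed
    have "scale_measure (emeasure S0 B) nu1 = Q"
    proof (rule measure_eqI_generator_eq[where E="?E" and \<Omega>="{0<..}" and A="\<lambda>i. {ereal (1 / real (Suc i))..}"])
      show "Int_stable ?E"
      proof (rule Int_stableI)
        fix a b assume "a \<in> ?E" "b \<in> ?E"
        then obtain r q where rq: "0 < r" "0 < q" "a = {ereal r..}" "b = {ereal q..}" by blast
        have "a \<inter> b = {ereal (max r q)..}"
          by (auto simp: rq max_def intro: order_trans[of "ereal r" "ereal q"] order_trans[of "ereal q" "ereal r"])
        then show "a \<inter> b \<in> ?E" using rq(1) by (intro CollectI exI[of _ "max r q"]) simp
      qed
      show "?E \<subseteq> Pow {0<..}" by (auto intro: less_le_trans[of 0 "ereal _"])
      show "sets (scale_measure (emeasure S0 B) nu1) = sigma_sets {0<..} ?E" "sets Q = sigma_sets {0<..} ?E"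
        by (simp_all add: Q_def sets_nu1 sets_ereal_positive)
      show "range (\<lambda>i. {ereal (1 / real (Suc i))..}) \<subseteq> ?E" by auto
      show "(\<Union>i. {ereal (1 / real (Suc i))..}) = {0<..}" by (rule positive_ereal_cover)
      show "emeasure (scale_measure (emeasure S0 B) nu1) {ereal (1 / real (Suc i))..} \<noteq> \<infinity>" for i
        by (simp add: nu1_atLeast ennreal_mult_eq_top_iff S0.emeasure_finite del: of_nat_Suc)
      fix X assume "X \<in> ?E"
      then obtain r where r: "0 < r" "X = {ereal r..}" by auto
      have "X \<in> sets nu1" unfolding sets_nu1 sets_ereal_positive using r by (auto intro!: sigma_sets.Basic)
      then show "emeasure (scale_measure (emeasure S0 B) nu1) X = emeasure Q X"
        using r B by (simp add: Q nu1_atLeast tail mult.commute)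
    qed
    then show "emeasure nu1 A * emeasure S0 B = emeasure ?P (A \<times> B)"
      using Q[OF A] by (metis emeasure_scale_measure mult.commute)
  qed
qed

section \<open>The limit product measure: tails and the Radon property\<close>

lemma sets_nu1_pair:
  assumes "sets S0 = sets (restrict_space borel delta_aleph)"
  shows "sets (nu1 \<Otimes>\<^sub>M S0) = sets (restrict_space borel ({0<..} \<times> delta_aleph))"
  using sets_pair_measure_cong[OF sets_nu1 assms]
  by (simp add: sets_pair_restrict_borel)

lemma nu1_pair_tail:
  assumes "prob_space S0" "sets S0 = sets (restrict_space borel delta_aleph)" "0 < r"
  shows "{ereal r..} \<times> delta_aleph \<in> sets (nu1 \<Otimes>\<^sub>M S0)"
    and "emeasure (nu1 \<Otimes>\<^sub>M S0) ({ereal r..} \<times> delta_aleph) = ennreal (1 / r)"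
proof -
  interpret S0: prob_space S0 by fact
  have d: "space S0 = delta_aleph"
    using sets_eq_imp_space_eq[OF assms(2)] by (simp add: space_restrict_space)
  have r: "{ereal r..} \<in> sets nu1"
    unfolding sets_nu1 sets_ereal_positive using assms(3) by (auto intro!: sigma_sets.Basic)
  show "{ereal r..} \<times> delta_aleph \<in> sets (nu1 \<Otimes>\<^sub>M S0)"
    using r sets.top[of S0] by (auto simp: d)
  show "emeasure (nu1 \<Otimes>\<^sub>M S0) ({ereal r..} \<times> delta_aleph) = ennreal (1 / r)"
    using r sets.top[of S0] S0.emeasure_space_1 S0.emeasure_pair_measure_Times[of "{ereal r..}" nu1 "space S0"]
    by (simp add: d nu1_atLeast[OF assms(3)])
qed

lemma nu1_pair_radon:
  assumes "prob_space S0" "sets S0 = sets (restrict_space borel delta_aleph)"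
  shows "nu1 \<Otimes>\<^sub>M S0 \<in> radon_measures ({0<..} \<times> delta_aleph)"
  unfolding radon_measures_def
proof (intro CollectI conjI allI impI)
  show "sets (nu1 \<Otimes>\<^sub>M S0) = sets (restrict_space borel ({0<..} \<times> delta_aleph))"
    by (rule sets_nu1_pair) fact
  fix K :: "(ereal \<times> ereal \<times> ereal) set" assume K: "compact K \<and> K \<subseteq> {0<..} \<times> delta_aleph"
  have "compact (fst ` K)" using K by (intro compact_continuous_image continuous_intros) auto
  moreover have "fst ` K \<subseteq> {0<..}" using K by auto
  ultimately obtain a where a: "0 < a" "fst ` K \<subseteq> {a..}" by (rule compact_ereal_bounded_below)
  \<comment> \<open>The lower bound a may be \<infinity>, while the tail formula needs a real
    endpoint.\<close>
  then obtain r where r: "0 < ereal r" "ereal r < a" using ereal_dense2[of 0 a] by auto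
  have "K \<subseteq> {ereal r..} \<times> delta_aleph"
  proof
    fix y assume y: "y \<in> K"
    then have "a \<le> fst y" using a(2) by auto
    then show "y \<in> {ereal r..} \<times> delta_aleph" using y K r(2) by (auto simp: mem_Times_iff)
  qed
  then have "emeasure (nu1 \<Otimes>\<^sub>M S0) K \<le> ennreal (1 / r)"
    using emeasure_mono[OF _ nu1_pair_tail(1)[OF assms], of K r] nu1_pair_tail(2)[OF assms, of r] r by simp
  also have "\<dots> < \<infinity>" by simp
  finally show "emeasure (nu1 \<Otimes>\<^sub>M S0) K < \<infinity>" .
qed

section \<open>Rank measures\<close>

text \<open>A positive larger anti-rank makes the smaller coordinate finite, so \<open>polar\<close>
  takes its generic branch. If the other anti-rank is 0, both sides have \<infinity> as the
  corresponding angle coordinate.\<close>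

lemma polar_rank_point_eq:
  assumes "0 < k" "0 < max (antirank1 n x i) (antirank2 n x i)"
  shows "polar (rank_point k n x i) = polar_rank_point k n x i"
proof -
  have *: "polar (ereal k / ereal (real a), ereal k / ereal (real b)) =
    (ereal k / max (ereal (real a)) (ereal (real b)),
      max (ereal (real a)) (ereal (real b)) / ereal (real a), max (ereal (real a)) (ereal (real b)) / ereal (real b))"
    if ab: "0 < max a b" for a b :: nat
  proof -
    consider "a = 0" "0 < b" | "0 < a" "b = 0" | "0 < a" "0 < b" using ab by (cases "a = 0"; cases "b = 0") auto
    then show ?thesis
    proof cases
      case 3
      then show ?thesis using assms(1)
        by (cases "a \<le> b") (auto simp: polar_def Let_def min_def max_def field_simps one_ereal_def)
    qed (use assms(1) in \<open>auto simp: polar_def Let_def min_def max_def one_ereal_def\<close>)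
  qed
  show ?thesis
    unfolding rank_point_def polar_rank_point_def Let_def by (rule *) (use assms(2) in simp)
qed

text \<open>A lower threshold is reached by more minima, so the larger of the two counts belongs to
  the smaller coordinate. The maximum is thus the ordinary anti-rank of the minimum among the
  minima.\<close>

lemma max_antirank:
  "max (antirank1 n x i) (antirank2 n x i)
    = card {j \<in> {1..n}. min (fst (x j)) (snd (x j)) \<ge> min (fst (x i)) (snd (x i))}"
proof (cases "fst (x i) \<le> snd (x i)")
  case True
  then have "antirank2 n x i \<le> antirank1 n x i"
    unfolding antirank1_def antirank2_def by (intro card_mono) auto
  with True show ?thesis by (simp add: antirank1_def min_def)
next
  case False
  then have "antirank1 n x i \<le> antirank2 n x i"
    unfolding antirank1_def antirank2_def by (intro card_mono) auto
  with False show ?thesis by (simp add: antirank2_def min_def)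
qed

lemma max_antirank_pos:
  assumes "i \<in> {1..n}" shows "0 < max (antirank1 n x i) (antirank2 n x i)"
  unfolding max_antirank using assms by (subst card_gt_0_iff) (auto intro!: exI[of _ i])

lemma rank_point_mem: 
  assumes "0 < k" shows "rank_point k n x i \<in> pos_quadrant"
proof -
  have "0 < ereal k / ereal (real a)" for a :: nat
    using assms by (cases "a = 0") auto
  then show ?thesis by (simp add: rank_point_def pos_quadrant_def)
qed

text \<open>Among the selected indices take one with the smallest value. Every selected index is
  counted in its anti-rank, ties included, and that anti-rank is at most q.\<close>

lemma card_small_antiranks:
  fixes Y :: "nat \<Rightarrow> real"
  assumes "finite I" "0 \<le> q"
  shows "real (card {i \<in> I. real (card {j \<in> I. Y i \<le> Y j}) \<le> q}) \<le> q"
proof (cases "{i \<in> I. real (card {j \<in> I. Y i \<le> Y j}) \<le> q} = {}")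
  case True
  then show ?thesis using assms(2) by (simp only: card.empty of_nat_0)
next
  case False
  let ?S = "{i \<in> I. real (card {j \<in> I. Y i \<le> Y j}) \<le> q}"
  have fin: "finite ?S" using assms(1) by simp
  define i where "i = arg_min_on Y ?S"
  have i: "i \<in> ?S" unfolding i_def by (rule arg_min_if_finite(1)[OF fin False])
  have "?S \<subseteq> {j \<in> I. Y i \<le> Y j}"
    unfolding i_def using arg_min_least[OF fin False] by blast
  then have "card ?S \<le> card {j \<in> I. Y i \<le> Y j}"
    using assms(1) by (intro card_mono) auto
  then have "real (card ?S) \<le> real (card {j \<in> I. Y i \<le> Y j})" by simp
  also have "\<dots> \<le> q" using i by simp
  finally show ?thesis .
qed

text \<open>A radius k / R of at least t means that the anti-rank R of the minimum is at most k /
  t.\<close>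

lemma card_rank_tail:
  assumes k: "0 < k" and t: "0 < t"
  shows "real (card {i \<in> {1..n}. ereal t \<le> fst (polar_rank_point k n x i)}) \<le> k / t"
proof -
  let ?Y = "\<lambda>j. min (fst (x j)) (snd (x j))"
  have "{i \<in> {1..n}. ereal t \<le> fst (polar_rank_point k n x i)}
      \<subseteq> {i \<in> {1..n}. real (card {j \<in> {1..n}. ?Y i \<le> ?Y j}) \<le> k / t}"
  proof (intro subsetI CollectI conjI)
    fix i assume "i \<in> {i \<in> {1..n}. ereal t \<le> fst (polar_rank_point k n x i)}"
    then have i: "i \<in> {1..n}" "ereal t \<le> fst (polar_rank_point k n x i)" by simp_all
    show "i \<in> {1..n}" by fact
    let ?R = "max (antirank1 n x i) (antirank2 n x i)"
    have R: "0 < ?R" by (rule max_antirank_pos) fact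
    have "fst (polar_rank_point k n x i) = ereal k / ereal (real ?R)"
      by (simp add: polar_rank_point_def Let_def max_def)
    moreover have "t \<le> k / real r" if "0 < r" "ereal t \<le> ereal k / ereal (real r)" for r :: nat
      using that by simp
    ultimately have "t \<le> k / real ?R" using i(2) R by metis
    then have "real ?R \<le> k / t" using R t by (simp add: field_simps)
    then show "real (card {j \<in> {1..n}. ?Y i \<le> ?Y j}) \<le> k / t" unfolding max_antirank .
  qed
  then have "card {i \<in> {1..n}. ereal t \<le> fst (polar_rank_point k n x i)}
      \<le> card {i \<in> {1..n}. real (card {j \<in> {1..n}. ?Y i \<le> ?Y j}) \<le> k / t}"
    by (intro card_mono) auto
  also have "real \<dots> \<le> k / t" using k t by (intro card_small_antiranks) auto
  finally show ?thesis by simp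
qed

section \<open>Empirical measures: Radon property, integrals, measurability\<close>

lemma empirical_measure_cong:
  "(\<And>i. i \<in> {1..n} \<Longrightarrow> x i = y i) \<Longrightarrow> empirical_measure F k n x = empirical_measure F k n y"
  unfolding empirical_measure_def scaled_image_def by (intro arg_cong2[where f=scale_measure] arg_cong2[where f=restrict_space] distr_cong) auto

lemma empirical_measure_radon:
  fixes F :: "'b::t2_space set"
  assumes "F \<in> sets borel"
  shows "empirical_measure F k n x \<in> radon_measures F"
  unfolding radon_measures_def
proof (intro CollectI conjI allI impI)
  show "sets (empirical_measure F k n x) = sets (restrict_space borel F)"
    by (simp add: empirical_measure_def sets_scaled_image)
  fix K assume K: "compact K \<and> K \<subseteq> F"
  then have "K \<in> sets (restrict_space borel F)"
    using assms by (subst sets_restrict_space_iff) (auto intro: borel_compact)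
  moreover have "(\<Sum>i=1..n. indicator K (x i) :: ennreal) < top"
    by (auto simp: less_top[symmetric] indicator_def)
  ultimately show "emeasure (empirical_measure F k n x) K < \<infinity>"
    using assms by (subst emeasure_empirical_measure) (auto simp: ennreal_mult_less_top)
qed

lemma integral_empirical_measure:
  fixes f :: "'b::topological_space \<Rightarrow> real"
  assumes F: "F \<in> sets borel" and k: "0 < k" and x: "\<And>i. i \<in> {1..n} \<Longrightarrow> x i \<in> F"
    and f: "f \<in> ck_plus F"
  shows "(\<integral>z. f z \<partial>empirical_measure F k n x) = (\<Sum>i=1..n. f (x i)) / k"
proof -
  have "(\<integral>z. f z \<partial>empirical_measure F k n x)
      = 1 / k * (\<integral>i. indicator F (x i) * f (x i) \<partial>count_space {1..n})"
    unfolding empirical_measure_def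
    by (rule integral_scaled_image) (use F k ck_plus_measurable[OF f] in auto)
  also have "(\<integral>i. indicator F (x i) * f (x i) \<partial>count_space {1..n}) = (\<Sum>i=1..n. f (x i))"
    using x by (auto simp: lebesgue_integral_count_space_finite intro!: sum.cong)
  finally show ?thesis by simp
qed

lemma borel_polar_space: "{0<..} \<times> delta_aleph \<in> sets (borel :: (ereal \<times> ereal \<times> ereal) measure)"
  unfolding borel_prod[symmetric, where 'a=ereal and 'b="ereal \<times> ereal"]
  by (intro pair_measureI borel_closed[OF closed_delta_aleph]) auto

lemma borel_pos_quadrant: "pos_quadrant \<in> sets borel"
  by (rule borel_open[OF open_pos_quadrant])

lemma integral_rank_measure:
  assumes "0 < k" "f \<in> ck_plus pos_quadrant"
  shows "(\<integral>z. f z \<partial>rank_measure k n x) = (\<Sum>i=1..n. f (rank_point k n x i)) / k"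
  unfolding rank_measure_def using assms
  by (intro integral_empirical_measure borel_pos_quadrant rank_point_mem)

lemma integral_polar_rank_measure:
  assumes "0 < k" "f \<in> ck_plus ({0<..} \<times> delta_aleph)"
  shows "(\<integral>z. f z \<partial>polar_rank_measure k n x) = (\<Sum>i=1..n. f (polar (rank_point k n x i))) / k"
proof -
  have "polar_rank_measure k n x = empirical_measure ({0<..} \<times> delta_aleph) k n (\<lambda>i. polar (rank_point k n x i))"
    unfolding polar_rank_measure_def
    by (intro empirical_measure_cong polar_rank_point_eq[symmetric] max_antirank_pos assms)
  then show ?thesis using assms
    by (simp only:) (intro integral_empirical_measure borel_polar_space polar_mem rank_point_mem)
qed

text \<open>No separability of the vague topology is needed for measurability, because the anti-ranks take
  only finitely many values.\<close>

lemma measurable_antirank_function: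
  assumes X: "\<And>i. X i \<in> borel_measurable M"
    and \<Phi>: "\<And>r. \<Phi> r \<in> space N"
  shows "(\<lambda>\<omega>. \<Phi> (\<lambda>i\<in>{1..n}. (antirank1 n (\<lambda>i. X i \<omega>) i, antirank2 n (\<lambda>i. X i \<omega>) i))) \<in> M \<rightarrow>\<^sub>M N"
proof -
  let ?\<rho> = "\<lambda>\<omega>. \<lambda>i\<in>{1..n}. (antirank1 n (\<lambda>i. X i \<omega>) i, antirank2 n (\<lambda>i. X i \<omega>) i)"
  \<comment> \<open>Anti-ranks are at most n, and the restriction to {1..n} makes the tuple
    extensional, so it takes values in a finite set and preimages of single tuples suffice.\<close>
  let ?A = "{1..n} \<rightarrow>\<^sub>E ({..n} \<times> {..n})"
  have [measurable]: "(\<lambda>\<omega>. fst (X i \<omega>)) \<in> borel_measurable M" "(\<lambda>\<omega>. snd (X i \<omega>)) \<in> borel_measurable M" for i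
    using X[of i] unfolding borel_prod[symmetric] by (auto intro: measurable_compose)
  have [measurable]: "(\<lambda>\<omega>. antirank1 n (\<lambda>i. X i \<omega>) i) \<in> M \<rightarrow>\<^sub>M count_space UNIV"
    "(\<lambda>\<omega>. antirank2 n (\<lambda>i. X i \<omega>) i) \<in> M \<rightarrow>\<^sub>M count_space UNIV" for i
    unfolding antirank1_def antirank2_def by measurable
  have "?\<rho> \<in> M \<rightarrow>\<^sub>M count_space ?A"
  proof (subst measurable_count_space_eq2, intro finite_PiE ballI finite_cartesian_product; (intro conjI ballI)?)
    have le: "antirank1 n x i \<le> n" "antirank2 n x i \<le> n" for x i
      unfolding antirank1_def antirank2_def
      by (rule order_trans[OF card_mono[of "{1..n}"]]; auto)+
    show "?\<rho> \<in> space M \<rightarrow> ?A" by (auto simp: le)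
    fix a assume a: "a \<in> ?A"
    have "?\<rho> -` {a} \<inter> space M = {\<omega> \<in> space M. \<forall>i\<in>{1..n}. antirank1 n (\<lambda>i. X i \<omega>) i = fst (a i) \<and> antirank2 n (\<lambda>i. X i \<omega>) i = snd (a i)}"
    proof -
      have "?\<rho> \<omega> = a \<longleftrightarrow> (\<forall>i\<in>{1..n}. antirank1 n (\<lambda>i. X i \<omega>) i = fst (a i) \<and> antirank2 n (\<lambda>i. X i \<omega>) i = snd (a i))" for \<omega>
      proof
        assume "\<forall>i\<in>{1..n}. antirank1 n (\<lambda>i. X i \<omega>) i = fst (a i) \<and> antirank2 n (\<lambda>i. X i \<omega>) i = snd (a i)"
        then show "?\<rho> \<omega> = a"
          using a by (intro extensionalityI[of _ "{1..n}"]) (auto simp: prod_eq_iff PiE_def)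
      qed auto
      then show ?thesis by blast
    qed
    also have "\<dots> \<in> sets M" by measurable
    finally show "?\<rho> -` {a} \<inter> space M \<in> sets M" .
  qed auto
  from measurable_compose[OF this, of \<Phi> N] \<Phi> show ?thesis by auto
qed

lemma measurable_rank_measure:
  assumes "\<And>i. X i \<in> borel_measurable M"
  shows "(\<lambda>\<omega>. rank_measure k n (\<lambda>i. X i \<omega>)) \<in> M \<rightarrow>\<^sub>M borel_of (vague_topology pos_quadrant)"
proof -
  \<comment> \<open>\<open>\<Phi>\<close> must give a Radon measure for every sequence of pairs,
    also for those that are no anti-ranks, such as (0, 0); points falling outside the cone are
    discarded.\<close>
  define \<Phi> where "\<Phi> r = empirical_measure pos_quadrant k n
    (\<lambda>i. (ereal k / ereal (real (fst (r i))), ereal k / ereal (real (snd (r i)))))" for r :: "nat \<Rightarrow> nat \<times> nat"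
  have "rank_measure k n x = \<Phi> (\<lambda>i\<in>{1..n}. (antirank1 n x i, antirank2 n x i))" for x
    unfolding rank_measure_def \<Phi>_def by (rule empirical_measure_cong) (simp add: rank_point_def)
  moreover have "\<Phi> r \<in> space (borel_of (vague_topology pos_quadrant))" for r
    unfolding space_borel_of topspace_vague_topology \<Phi>_def by (rule empirical_measure_radon[OF borel_pos_quadrant])
  ultimately show ?thesis using measurable_antirank_function[OF assms, where \<Phi>=\<Phi>] by simp
qed

lemma measurable_polar_rank_measure:
  assumes "\<And>i. X i \<in> borel_measurable M"
  shows "(\<lambda>\<omega>. polar_rank_measure k n (\<lambda>i. X i \<omega>)) \<in> M \<rightarrow>\<^sub>M borel_of (vague_topology ({0<..} \<times> delta_aleph))"
proof -
  define \<Phi> where "\<Phi> r = empirical_measure ({0<..} \<times> delta_aleph) k n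
    (\<lambda>i. let R1 = ereal (real (fst (r i))); R2 = ereal (real (snd (r i))); R = max R1 R2
      in (ereal k / R, (R / R1, R / R2)))" for r :: "nat \<Rightarrow> nat \<times> nat"
  have "polar_rank_measure k n x = \<Phi> (\<lambda>i\<in>{1..n}. (antirank1 n x i, antirank2 n x i))" for x
    unfolding polar_rank_measure_def \<Phi>_def by (rule empirical_measure_cong) (simp add: polar_rank_point_def)
  moreover have "\<Phi> r \<in> space (borel_of (vague_topology ({0<..} \<times> delta_aleph)))" for r
    unfolding space_borel_of topspace_vague_topology \<Phi>_def by (rule empirical_measure_radon[OF borel_polar_space])
  ultimately show ?thesis using measurable_antirank_function[OF assms, where \<Phi>=\<Phi>] by simp
qed

section \<open>Truncation\<close>

lemma cutoff_tail: "0 < t \<Longrightarrow> 0 < r \<Longrightarrow> 1 - cutoff t r \<le> indicator {ereal t..} r"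
  using cutoff_eq_1[of t r] cutoff_bounds(1)[of t r]
  by (cases "r \<le> ereal t") (auto simp: indicator_def)

text \<open>The cutoff differs from 1 only at radii above t. This pointwise bound is integrated
  below against both the polar rank measure and its limit.\<close>

lemma cutoff_truncation_error:
  assumes "f \<in> ck_plus ({0<..} \<times> delta_aleph)" "\<And>y. y \<in> {0<..} \<times> delta_aleph \<Longrightarrow> f y \<le> B"
    and t: "0 < t" and y: "y \<in> {0<..} \<times> delta_aleph"
  shows "\<bar>f y - cutoff t (fst y) * f y\<bar> \<le> B * indicator ({ereal t..} \<times> delta_aleph) y"
proof -
  have f: "0 \<le> f y" "f y \<le> B" using assms by (auto simp: ck_plus_def)
  have "\<bar>f y - cutoff t (fst y) * f y\<bar> = f y * (1 - cutoff t (fst y))"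
    using mult_left_le_one_le[OF f(1) cutoff_bounds] by (simp add: algebra_simps)
  also have "\<dots> \<le> B * indicator {ereal t..} (fst y)"
    using f cutoff_tail[OF t, of "fst y"] cutoff_bounds(2)[of t "fst y"] y by (intro mult_mono) auto
  also have "indicator {ereal t..} (fst y) = (indicator ({ereal t..} \<times> delta_aleph) y :: real)"
    using y by (auto simp: indicator_def mem_Times_iff)
  finally show ?thesis .
qed

text \<open>At most k / t summands are affected, each by at most B. Division by k leaves a bound
  free of n, k and the sample.\<close>

lemma polar_rank_truncation:
  assumes f: "f \<in> ck_plus ({0<..} \<times> delta_aleph)" and B: "\<And>y. y \<in> {0<..} \<times> delta_aleph \<Longrightarrow> f y \<le> B"
    and t: "0 < t" and k: "0 < k" and "0 \<le> B"
  shows "\<bar>(\<integral>y. f y \<partial>polar_rank_measure k n x)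
     - (\<integral>z. cutoff t (min (fst z) (snd z)) * f (polar z) \<partial>rank_measure k n x)\<bar> \<le> B / t"
proof -
  let ?p = "\<lambda>i. polar (rank_point k n x i)"
  let ?J = "{i \<in> {1..n}. ereal t \<le> fst (polar_rank_point k n x i)}"
  have p: "?p i \<in> {0<..} \<times> delta_aleph" for i by (intro polar_mem rank_point_mem k)
  have "(\<integral>y. f y \<partial>polar_rank_measure k n x)
     - (\<integral>z. cutoff t (min (fst z) (snd z)) * f (polar z) \<partial>rank_measure k n x)
     = (\<Sum>i=1..n. f (?p i) - cutoff t (fst (?p i)) * f (?p i)) / k"
    by (simp only: integral_polar_rank_measure[OF k f] integral_rank_measure[OF k ck_plus_cutoff_polar[OF f t]]
        fst_polar sum_subtractf diff_divide_distrib)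
  also have "\<bar>\<dots>\<bar> \<le> (\<Sum>i=1..n. B * indicator ?J i) / k"
  proof -
    have "\<bar>f (?p i) - cutoff t (fst (?p i)) * f (?p i)\<bar> \<le> B * indicator ?J i" if i: "i \<in> {1..n}" for i
    proof -
      have "indicator ({ereal t..} \<times> delta_aleph) (?p i) = (indicator ?J i :: real)"
        using p[of i] i polar_rank_point_eq[OF k max_antirank_pos[OF i, of x]]
        by (auto simp: indicator_def mem_Times_iff)
      then show ?thesis using cutoff_truncation_error[OF f B t p[of i]] by simp
    qed
    then have "\<bar>\<Sum>i=1..n. f (?p i) - cutoff t (fst (?p i)) * f (?p i)\<bar> \<le> (\<Sum>i=1..n. B * indicator ?J i)"
      by (intro order_trans[OF sum_abs] sum_mono)
    then show ?thesis using k by (simp add: abs_divide divide_right_mono)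
  qed
  also have "(\<Sum>i=1..n. B * indicator ?J i) = B * real (card ?J)"
    by (simp add: sum_distrib_left[symmetric] indicator_def sum.If_cases Int_def)
  also have "B * real (card ?J) / k \<le> B * (k / t) / k"
    using k \<open>0 \<le> B\<close> by (intro divide_right_mono mult_left_mono card_rank_tail t) auto
  finally show ?thesis using k by simp
qed

text \<open>The pushforward identity moves the truncated integral to the product measure, whose tail
  beyond t has mass 1 / t because \<open>S0\<close> has total mass 1.\<close>

lemma polar_limit_truncation:
  assumes \<nu>t: "\<nu>t \<in> radon_measures pos_quadrant"
    and S0: "prob_space S0" "sets S0 = sets (restrict_space borel delta_aleph)"
    and push: "nu1 \<Otimes>\<^sub>M S0 = distr \<nu>t (restrict_space borel ({0<..} \<times> delta_aleph)) polar"
    and f: "f \<in> ck_plus ({0<..} \<times> delta_aleph)" and B: "\<And>y. y \<in> {0<..} \<times> delta_aleph \<Longrightarrow> f y \<le> B"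
    and t: "0 < t"
  shows "\<bar>(\<integral>y. f y \<partial>(nu1 \<Otimes>\<^sub>M S0)) - (\<integral>z. cutoff t (min (fst z) (snd z)) * f (polar z) \<partial>\<nu>t)\<bar> \<le> B / t"
proof -
  let ?F = "{0<..} \<times> delta_aleph :: (ereal \<times> ereal \<times> ereal) set"
  let ?N = "nu1 \<Otimes>\<^sub>M S0"
  let ?g = "\<lambda>y. cutoff t (fst y) * f y"
  have sN: "sets ?N = sets (restrict_space borel ?F)" by (rule sets_nu1_pair[OF S0(2)])
  have spN: "space ?N = ?F" using sets_eq_imp_space_eq[OF sN] by (simp add: space_restrict_space)
  have s\<nu>: "sets \<nu>t = sets (restrict_space borel pos_quadrant)" using \<nu>t by (simp add: radon_measures_def)
  have pm: "polar \<in> \<nu>t \<rightarrow>\<^sub>M restrict_space borel ?F" by (rule measurable_polar_restrict[OF s\<nu>])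
  have gm: "?g \<in> borel_measurable (restrict_space borel ?F)"
  proof (intro borel_measurable_continuous_on_restrict continuous_on_mult)
    show "continuous_on ?F (\<lambda>y. cutoff t (fst y))"
      by (rule continuous_on_compose2[OF continuous_on_cutoff[OF t]]) (auto intro!: continuous_intros)
    show "continuous_on ?F f" using f by (simp add: ck_plus_def)
  qed
  have "(\<integral>y. ?g y \<partial>?N) = (\<integral>z. cutoff t (min (fst z) (snd z)) * f (polar z) \<partial>\<nu>t)"
    unfolding push by (subst integral_distr[OF pm gm]) (simp add: fst_polar)
  moreover have fi: "integrable ?N f" by (rule ck_plus_integrable[OF f nu1_pair_radon[OF S0]])
  moreover have gi: "integrable ?N ?g"
  proof (rule Bochner_Integration.integrable_bound[OF fi])
    show "?g \<in> borel_measurable ?N" using gm by (simp add: measurable_cong_sets[OF sN refl])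
    show "AE y in ?N. norm (?g y) \<le> norm (f y)"
      using cutoff_bounds by (intro AE_I2) (simp add: abs_mult mult_left_le_one_le)
  qed
  moreover have "\<bar>\<integral>y. f y - ?g y \<partial>?N\<bar> \<le> B / t"
  proof -
    note T = nu1_pair_tail[OF S0 t]
    have "\<bar>\<integral>y. f y - ?g y \<partial>?N\<bar> \<le> (\<integral>y. \<bar>f y - ?g y\<bar> \<partial>?N)" by (rule integral_abs_bound)
    also have "\<dots> \<le> (\<integral>y. B * indicator ({ereal t..} \<times> delta_aleph) y \<partial>?N)"
    proof (rule integral_mono)
      show "integrable ?N (\<lambda>y. B * indicator ({ereal t..} \<times> delta_aleph) y)"
        using T by (intro integrable_mult_right integrable_real_indicator) auto
      show "\<bar>f y - ?g y\<bar> \<le> B * indicator ({ereal t..} \<times> delta_aleph) y" if "y \<in> space ?N" for y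
        using cutoff_truncation_error[OF f B t, of y] that spN by simp
    qed (use fi gi in auto)
    also have "\<dots> = B / t" using T t by (simp add: measure_def)
    finally show ?thesis .
  qed
  ultimately show ?thesis by simp
qed

lemma weak_limit_rank_iff_polar_rank:
  assumes M: "prob_space M" and X: "\<And>i. X i \<in> borel_measurable M"
    and k: "filterlim k at_top sequentially"
    and \<nu>t: "\<nu>t \<in> radon_measures pos_quadrant"
    and S0: "prob_space S0" "sets S0 = sets (restrict_space borel delta_aleph)"
    and push: "nu1 \<Otimes>\<^sub>M S0 = distr \<nu>t (restrict_space borel ({0<..} \<times> delta_aleph)) polar"
  shows "weakly_converges (vague_topology pos_quadrant) M
           (\<lambda>n \<omega>. rank_measure (k n) n (\<lambda>i. X i \<omega>)) (\<lambda>_. \<nu>t)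
     \<longleftrightarrow>
         weakly_converges (vague_topology ({0<..} \<times> delta_aleph)) M
           (\<lambda>n \<omega>. polar_rank_measure (k n) n (\<lambda>i. X i \<omega>)) (\<lambda>_. nu1 \<Otimes>\<^sub>M S0)"
    (is "weakly_converges ?T M ?Y _ \<longleftrightarrow> weakly_converges ?T' M ?Y' _")
proof
  interpret prob_space M by fact
  let ?F = "{0<..} \<times> delta_aleph :: (ereal \<times> ereal \<times> ereal) set"
  let ?N = "nu1 \<Otimes>\<^sub>M S0"
  \<comment> \<open>The integral identities and bounds for the rank measures require k > 0, which
    holds only from some n on; the comparisons are therefore eventual.\<close>
  have k_pos: "eventually (\<lambda>n. 0 < k n) sequentially" using k by (auto simp: filterlim_at_top_dense)
  have s\<nu>: "sets \<nu>t = sets (restrict_space borel pos_quadrant)" using \<nu>t by (simp add: radon_measures_def)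
  have sp\<nu>: "space \<nu>t = pos_quadrant" using sets_eq_imp_space_eq[OF s\<nu>] by (simp add: space_restrict_space)
  {
    assume w: "weakly_converges ?T M ?Y (\<lambda>_. \<nu>t)"
    show "weakly_converges ?T' M ?Y' (\<lambda>_. ?N)"
    proof (rule weakly_converges_constI[OF M measurable_polar_rank_measure[OF X] nu1_pair_radon[OF S0]])
      fix f :: "ereal \<times> ereal \<times> ereal \<Rightarrow> real" and \<epsilon> :: real
      assume f: "f \<in> ck_plus ?F" and \<epsilon>: "0 < \<epsilon>"
      obtain B where B: "0 < B" "\<And>y. y \<in> ?F \<Longrightarrow> f y \<le> B" using ck_plus_bounded[OF f] by blast
      \<comment> \<open>Each of the two truncation errors becomes at most \<epsilon> / 4, so a
        deviation of \<epsilon> of the polar integrals forces one of \<epsilon> / 2 of the truncated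
        integrals.\<close>
      define t where "t = 4 * B / \<epsilon>"
      have t: "0 < t" and Bt: "B / t = \<epsilon> / 4" using B \<epsilon> by (simp_all add: t_def)
      let ?h = "\<lambda>z. cutoff t (min (fst z) (snd z)) * f (polar z)"
      have h: "?h \<in> ck_plus pos_quadrant" by (rule ck_plus_cutoff_polar[OF f t])
      have meas: "(\<lambda>\<omega>. \<integral>z. ?h z \<partial>?Y n \<omega>) \<in> borel_measurable M" for n
        by (rule measurable_compose[OF measurable_rank_measure[OF X]
              continuous_map_measurable_borel_of[OF continuous_map_vague_integral[OF h]]])
      have lim: "(\<lambda>n. prob {\<omega> \<in> space M. \<bar>(\<integral>z. ?h z \<partial>?Y n \<omega>) - (\<integral>z. ?h z \<partial>\<nu>t)\<bar> \<ge> \<epsilon> / 2}) \<longlonglongrightarrow> 0"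
        by (rule weakly_converges_constD[OF M w h]) (use \<epsilon> in simp)
      have le: "eventually (\<lambda>n. prob {\<omega> \<in> space M. \<bar>(\<integral>y. f y \<partial>?Y' n \<omega>) - (\<integral>y. f y \<partial>?N)\<bar> \<ge> \<epsilon>}
          \<le> prob {\<omega> \<in> space M. \<bar>(\<integral>z. ?h z \<partial>?Y n \<omega>) - (\<integral>z. ?h z \<partial>\<nu>t)\<bar> \<ge> \<epsilon> / 2}) sequentially"
        using k_pos
      proof eventually_elim
        case (elim n)
        show ?case
        proof (rule finite_measure_mono)
          show "{\<omega> \<in> space M. \<bar>(\<integral>z. ?h z \<partial>?Y n \<omega>) - (\<integral>z. ?h z \<partial>\<nu>t)\<bar> \<ge> \<epsilon> / 2} \<in> events"
            using meas[of n] by measurable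
          have N: "\<bar>(\<integral>y. f y \<partial>?N) - (\<integral>z. ?h z \<partial>\<nu>t)\<bar> \<le> \<epsilon> / 4"
            using polar_limit_truncation[OF \<nu>t S0 push f B(2) t] by (simp only: Bt)
          have Y: "\<bar>(\<integral>y. f y \<partial>?Y' n \<omega>) - (\<integral>z. ?h z \<partial>?Y n \<omega>)\<bar> \<le> \<epsilon> / 4" for \<omega>
            using polar_rank_truncation[OF f B(2) t elim] B(1) by (simp only: Bt less_imp_le)
          have "\<epsilon> / 2 \<le> \<bar>(\<integral>z. ?h z \<partial>?Y n \<omega>) - (\<integral>z. ?h z \<partial>\<nu>t)\<bar>"
            if "\<epsilon> \<le> \<bar>(\<integral>y. f y \<partial>?Y' n \<omega>) - (\<integral>y. f y \<partial>?N)\<bar>" for \<omega>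
            using N Y[of \<omega>] that by linarith
          then show "{\<omega> \<in> space M. \<bar>(\<integral>y. f y \<partial>?Y' n \<omega>) - (\<integral>y. f y \<partial>?N)\<bar> \<ge> \<epsilon>}
            \<subseteq> {\<omega> \<in> space M. \<bar>(\<integral>z. ?h z \<partial>?Y n \<omega>) - (\<integral>z. ?h z \<partial>\<nu>t)\<bar> \<ge> \<epsilon> / 2}" by blast
        qed
      qed
      show "(\<lambda>n. prob {\<omega> \<in> space M. \<bar>(\<integral>y. f y \<partial>?Y' n \<omega>) - (\<integral>y. f y \<partial>?N)\<bar> \<ge> \<epsilon>}) \<longlonglongrightarrow> 0"
        by (rule tendsto_sandwich[OF _ le tendsto_const lim]) simp
    qed
  }
  {
    assume w: "weakly_converges ?T' M ?Y' (\<lambda>_. ?N)"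
    show "weakly_converges ?T M ?Y (\<lambda>_. \<nu>t)"
    proof (rule weakly_converges_constI[OF M measurable_rank_measure[OF X] \<nu>t])
      fix f :: "ereal \<times> ereal \<Rightarrow> real" and \<epsilon> :: real
      assume f: "f \<in> ck_plus pos_quadrant" and \<epsilon>: "0 < \<epsilon>"
      let ?h = "\<lambda>y. f (unpolar y)"
      have h: "?h \<in> ck_plus ?F" by (rule ck_plus_comp_unpolar[OF f])
      \<comment> \<open>In this direction the integrals agree exactly, since \<open>unpolar\<close>
        undoes \<open>polar\<close> on the whole quadrant, the corner included.\<close>
      have "(\<integral>y. ?h y \<partial>?N) = (\<integral>z. ?h (polar z) \<partial>\<nu>t)"
        unfolding push by (rule integral_distr[OF measurable_polar_restrict[OF s\<nu>] ck_plus_measurable[OF h refl]])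
      also have "\<dots> = (\<integral>z. f z \<partial>\<nu>t)"
        by (rule Bochner_Integration.integral_cong) (simp_all add: sp\<nu> unpolar_polar)
      finally have N: "(\<integral>y. ?h y \<partial>?N) = (\<integral>z. f z \<partial>\<nu>t)" .
      have Y: "(\<integral>y. ?h y \<partial>?Y' n \<omega>) = (\<integral>z. f z \<partial>?Y n \<omega>)" if "0 < k n" for n \<omega>
        by (simp only: integral_polar_rank_measure[OF that h] integral_rank_measure[OF that f]
            unpolar_polar[OF rank_point_mem[OF that]])
      have "(\<lambda>n. prob {\<omega> \<in> space M. \<bar>(\<integral>y. ?h y \<partial>?Y' n \<omega>) - (\<integral>y. ?h y \<partial>?N)\<bar> \<ge> \<epsilon>}) \<longlonglongrightarrow> 0"
        by (rule weakly_converges_constD[OF M w h \<epsilon>])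
      then show "(\<lambda>n. prob {\<omega> \<in> space M. \<bar>(\<integral>z. f z \<partial>?Y n \<omega>) - (\<integral>z. f z \<partial>\<nu>t)\<bar> \<ge> \<epsilon>}) \<longlonglongrightarrow> 0"
        by (rule Lim_transform_eventually) (use k_pos in eventually_elim, simp only: N Y)
    qed
  }
qed

theorem proposition2p10:
  fixes M :: "'a measure"
    and X :: "nat \<Rightarrow> 'a \<Rightarrow> real \<times> real"
    and k :: "nat \<Rightarrow> real"
    and \<nu>t S0 :: "(ereal \<times> ereal) measure"
  assumes "prob_space M"
    and "prob_space.indep_vars M (\<lambda>_. borel) X UNIV"
    and "\<And>i. distr M borel (X i) = distr M borel (X 0)"
    and "standard_case_hidden_doa (distr M borel (X 0))"
    and "standardized_hidden_measure (distr M borel (X 0)) \<nu>t"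
    and "hidden_spectral_measure \<nu>t S0"
    and "filterlim k at_top sequentially"
    and "filterlim (\<lambda>n. real n / k n) at_top sequentially"
  shows "weakly_converges (vague_topology pos_quadrant) M
           (\<lambda>n \<omega>. rank_measure (k n) n (\<lambda>i. X i \<omega>)) (\<lambda>_. \<nu>t)
     \<longleftrightarrow>
         weakly_converges (vague_topology ({0<..} \<times> delta_aleph)) M
           (\<lambda>n \<omega>. polar_rank_measure (k n) n (\<lambda>i. X i \<omega>)) (\<lambda>_. nu1 \<Otimes>\<^sub>M S0)"
proof (rule weak_limit_rank_iff_polar_rank)
  interpret prob_space M by fact
  show X: "X i \<in> borel_measurable M" for i
    using assms(2) by (simp add: indep_vars_def2)
  show \<nu>t: "\<nu>t \<in> radon_measures pos_quadrant"
    using assms(5) limitin_topspace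
    by (fastforce simp: standardized_hidden_measure_def vaguely_converges_def topspace_vague_topology)
  show "nu1 \<Otimes>\<^sub>M S0 = distr \<nu>t (restrict_space borel ({0<..} \<times> delta_aleph)) polar"
    using \<nu>t standardized_hidden_measure_infinity[OF prob_space_distr[OF X] _ assms(5)] assms(6)
    by (intro polar_pushforward) simp_all
  show "prob_space S0" "sets S0 = sets (restrict_space borel delta_aleph)"
    using assms(6) by (simp_all add: hidden_spectral_measure_def)
qed fact+

end
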